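(* Let $k$ be a commutative ring with $1/2\in k$ and let $V=\oplus_{i\ge0}V_i$ be a $\mathbb{Z}_{\ge0}$-graded vertex algebra over $k$. Put $A=V_0$, let $\Omega\subset V_1$ be the $k$-submodule generated by all elements $a_{(-1)}\partial b$ ($a,b\in A$), $T=V_1/\Omega$, $\pi:V_1\to T$ the projection, and suppose that $s:T\to V_1$ is a $k$-linear map with $\pi\circ s=\mathrm{Id}_T$. Define $$\gamma(a,\tau)=s(a\tau)-a_{(-1)}s(\tau),\qquad \langle\tau_1,\tau_2\rangle=s(\tau_1)_{(1)}s(\tau_2),\qquad c(\tau_1,\tau_2)=s([\tau_1,\tau_2])-[s(\tau_1),s(\tau_2)]$$ for $a\in A$, $\tau,\tau_i\in T$, where for $x,y\in V_1$, $[x,y]:=\frac12(x_{(0)}y-y_{(0)}x)$. Then the septuple $\mathcal{A}=(A,T,\Omega,\partial,\gamma,\langle\,,\rangle,c)$ is a vertex algebroid.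
   Context: A $\mathbb{Z}_{\ge0}$-graded vertex algebra over $k$ is a graded $k$-module $V=\oplus_{i\ge0}V_i$ with a vacuum $\mathbf{1}\in V_0$ and bilinear operations $a_{(n)}b$ of degree $-n-1$ ($n\in\mathbb{Z}$) such that $\mathbf{1}_{(n)}a=\delta_{n,-1}a$, $a_{(-1)}\mathbf{1}=a$, $a_{(n)}\mathbf{1}=0$ for $n\ge0$, and for all $m,n,l\in\mathbb{Z}$ $$\sum_{j\ge0}\binom mj(a_{(n+j)}b)_{(m+l-j)}c=\sum_{j\ge0}(-1)^j\binom nj\{a_{(m+n-j)}b_{(l+j)}c-(-1)^nb_{(n+l-j)}a_{(m+j)}c\}.$$ Put $\partial a=a_{(-2)}\mathbf{1}$. Structures used on $(A,T,\Omega)$, all well defined: $A$ is a commutative $k$-algebra under $ab=a_{(-1)}b$ with unit $\mathbf{1}$; $\Omega$ is an $A$-module under $a\omega=a_{(-1)}\omega$ and $\partial:A\to\Omega$ is a derivation; on $T$, the $A$-module structure is induced by $a_{(-1)}x$, the Lie bracket by $x_{(0)}y$, the action of $T$ on $A$ by $\tau(a)=x_{(0)}a$ and on $\Omega$ by $\tau(\omega)=x_{(0)}\omega$ (where $\pi(x)=\tau$), and $\langle\tau,\omega\rangle=x_{(1)}\omega$ defines $T\times\Omega\to A$; the pairing is $0$ on $\Omega\times\Omega$. A vertex algebroid is $(A,T,\Omega,\partial,\gamma,\langle\,,\rangle,c)$ where: $A$ is a commutative $k$-algebra; $T$ is a Lie $A$-algebroid (a Lie algebra acting on $A$ by derivations,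 with an $A$-module structure such that $[\tau,a\nu]=a[\tau,\nu]+\tau(a)\nu$, $(a\tau)(b)=a\tau(b)$); $\Omega$ is an $A$-module with an action of the Lie algebra $T$; $\partial:A\to\Omega$ is a derivation commuting with $T$; $\langle\,,\rangle:(T\oplus\Omega)^2\to A$ is symmetric $k$-bilinear, zero on $\Omega\times\Omega$, $A$-bilinear on $T\times\Omega$, with $\langle\tau,\partial a\rangle=\tau(a)$, $\tau(a\omega)=\tau(a)\omega+a\tau(\omega)$, $(a\tau)(\omega)=a\tau(\omega)+\langle\tau,\omega\rangle\partial a$, $\tau(\langle\nu,\omega\rangle)=\langle[\tau,\nu],\omega\rangle+\langle\nu,\tau(\omega)\rangle$; $c:T\times T\to\Omega$ is skew symmetric $k$-bilinear, $\gamma:A\times T\to\Omega$ is $k$-bilinear; and (A1) $\gamma(a,b\tau)=\gamma(ab,\tau)-a\gamma(b,\tau)-\tau(a)\partial b-\tau(b)\partial a$; (A2) $\langle a\tau_1,\tau_2\rangle=a\langle\tau_1,\tau_2\rangle+\langle\gamma(a,\tau_1),\tau_2\rangle-\tau_1\tau_2(a)$; (A3) $c(a\tau_1,\tau_2)=ac(\tau_1,\tau_2)+\gamma(a,[\tau_1,\tau_2])-\gamma(\tau_2(a),\tau_1)+\tau_2(\gamma(a,\tau_1))-\frac12\langle\tau_1,\tau_2\rangle\partial a+\frac12\partial\tau_1\tau_2(a)-\frac12\partial\langle\tau_2,\gamma(a,\tau_1)\rangle$; (A4) $\langle[\tau_1,\tau_2],\tau_3\rangle+\langle\tau_2,[\tau_1,\tau_3]\rangle=\tau_1(\langle\tau_2,\tau_3\rangle)-\frac12\tau_2(\langle\tau_1,\tau_3\rangle)-\frac12\tau_3(\langle\tau_1,\tau_2\rangle)+\langle\tau_2,c(\tau_1,\tau_3)\rangle+\langle\tau_3,c(\tau_1,\tau_2)\rangle$;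 (A5) $d_{Lie}c(\tau_1,\tau_2,\tau_3)=-\frac12\partial\{\langle[\tau_1,\tau_2],\tau_3\rangle+\langle[\tau_1,\tau_3],\tau_2\rangle-\langle[\tau_2,\tau_3],\tau_1\rangle-\tau_1(\langle\tau_2,\tau_3\rangle)+\tau_2(\langle\tau_1,\tau_3\rangle)-2\langle\tau_3,c(\tau_1,\tau_2)\rangle\}$, with $d_{Lie}c(\tau_1,\tau_2,\tau_3)=\tau_1(c(\tau_2,\tau_3))-\tau_2(c(\tau_1,\tau_3))+\tau_3(c(\tau_1,\tau_2))-c([\tau_1,\tau_2],\tau_3)+c([\tau_1,\tau_3],\tau_2)-c([\tau_2,\tau_3],\tau_1)$. *)

theory Defs
  imports "HOL-Algebra.Module" "HOL-Algebra.AbelCoset"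
begin

section \<open>Linear algebra over a commutative ring\<close>

definition linear_map ::
  "('k, 'r) ring_scheme \<Rightarrow> ('k, 'a, 'm) module_scheme \<Rightarrow> ('k, 'b, 'n) module_scheme \<Rightarrow> ('a \<Rightarrow> 'b) \<Rightarrow> bool"
  where "linear_map k M N f \<longleftrightarrow>
    f \<in> carrier M \<rightarrow> carrier N \<and>
    (\<forall>x \<in> carrier M. \<forall>y \<in> carrier M. f (x \<oplus>\<^bsub>M\<^esub> y) = f x \<oplus>\<^bsub>N\<^esub> f y) \<and>
    (\<forall>r \<in> carrier k. \<forall>x \<in> carrier M. f (r \<odot>\<^bsub>M\<^esub> x) = r \<odot>\<^bsub>N\<^esub> f x)"

definition bilinear_map ::
  "('k, 'r) ring_scheme \<Rightarrow> ('k, 'a, 'm) module_scheme \<Rightarrow> ('k, 'b, 'n) module_scheme \<Rightarrow>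
   ('k, 'c, 'p) module_scheme \<Rightarrow> ('a \<Rightarrow> 'b \<Rightarrow> 'c) \<Rightarrow> bool"
  where "bilinear_map k M N P f \<longleftrightarrow>
    (\<forall>x \<in> carrier M. linear_map k N P (f x)) \<and>
    (\<forall>y \<in> carrier N. linear_map k M P (\<lambda>x. f x y))"

definition half :: "('k, 'r) ring_scheme \<Rightarrow> 'k"
  where "half k = inv\<^bsub>k\<^esub> (\<one>\<^bsub>k\<^esub> \<oplus>\<^bsub>k\<^esub> \<one>\<^bsub>k\<^esub>)"

text \<open>Sum of a finitely supported family indexed by the natural numbers.\<close>

definition supp_sum :: "('a, 'm) ring_scheme \<Rightarrow> (nat \<Rightarrow> 'a) \<Rightarrow> 'a"
  where "supp_sum M f = finsum M f {j. f j \<noteq> \<zero>\<^bsub>M\<^esub>}"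

text \<open>The ring components \<open>mult\<close> and \<open>one\<close> of a module record carry no meaning for
  modules that are not algebras; they are left undefined.\<close>

definition direct_sum ::
  "('k, 'a, 'm) module_scheme \<Rightarrow> ('k, 'b, 'n) module_scheme \<Rightarrow> ('k, 'a \<times> 'b) module"
  where "direct_sum M N =
    \<lparr>carrier = carrier M \<times> carrier N, mult = undefined, one = undefined,
     zero = (\<zero>\<^bsub>M\<^esub>, \<zero>\<^bsub>N\<^esub>),
     add = (\<lambda>(x, y) (x', y'). (x \<oplus>\<^bsub>M\<^esub> x', y \<oplus>\<^bsub>N\<^esub> y')),
     smult = (\<lambda>r (x, y). (r \<odot>\<^bsub>M\<^esub> x, r \<odot>\<^bsub>N\<^esub> y))\<rparr>"


section \<open>Modules over a commutative $k$-algebra\<close>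

text \<open>A $k$-module together with a second scalar multiplication, by elements of a
  $k$-algebra \<open>A\<close>.\<close>

record ('k, 'a, 'm) amodule = "('k, 'm) module" +
  amult :: "'a \<Rightarrow> 'm \<Rightarrow> 'm" (infixr \<open>\<bullet>\<index>\<close> 72)

definition as_module :: "('k, 'a, 'm, 'z) amodule_scheme \<Rightarrow> ('a, 'm) module"
  where "as_module M =
    \<lparr>carrier = carrier M, mult = undefined, one = undefined, zero = \<zero>\<^bsub>M\<^esub>,
     add = add M, smult = amult M\<rparr>"

definition is_amodule ::
  "('k, 'r) ring_scheme \<Rightarrow> ('k, 'a, 'x) module_scheme \<Rightarrow> ('k, 'a, 'm, 'z) amodule_scheme \<Rightarrow> bool"
  where "is_amodule k A M \<longleftrightarrow>
    algebra k A \<and> module k M \<and> module A (as_module M) \<and>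
    (\<forall>r \<in> carrier k. \<forall>a \<in> carrier A. \<forall>x \<in> carrier M.
       (r \<odot>\<^bsub>A\<^esub> a) \<bullet>\<^bsub>M\<^esub> x = r \<odot>\<^bsub>M\<^esub> (a \<bullet>\<^bsub>M\<^esub> x))"


section \<open>Lie algebroids and vertex algebroids\<close>

text \<open>\<open>bracket T \<tau> \<nu>\<close> is $[\tau,\nu]$, \<open>anchor T \<tau> a\<close> is $\tau(a)$, and for a module
  over the Lie algebra $T$, \<open>lie_act W \<tau> \<omega>\<close> is $\tau(\omega)$.\<close>

record ('k, 'a, 't) lie_oid = "('k, 'a, 't) amodule" +
  bracket :: "'t \<Rightarrow> 't \<Rightarrow> 't"
  anchor :: "'t \<Rightarrow> 'a \<Rightarrow> 'a"

record ('k, 'a, 't, 'w) lie_amodule = "('k, 'a, 'w) amodule" +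
  lie_act :: "'t \<Rightarrow> 'w \<Rightarrow> 'w"

locale lie_algebroid =
  fixes k :: "('k, 'r) ring_scheme"
    and A :: "('k, 'a, 'x) module_scheme"
    and T :: "('k, 'a, 't, 'y) lie_oid_scheme"
  assumes A_algebra: "algebra k A"
    and T_amodule: "is_amodule k A T"
    and bracket_bilinear: "bilinear_map k T T T (bracket T)"
    and bracket_alt: "\<tau> \<in> carrier T \<Longrightarrow> bracket T \<tau> \<tau> = \<zero>\<^bsub>T\<^esub>"
    and jacobi: "\<lbrakk>\<tau> \<in> carrier T; \<nu> \<in> carrier T; \<mu> \<in> carrier T\<rbrakk> \<Longrightarrow>
      bracket T \<tau> (bracket T \<nu> \<mu>) \<oplus>\<^bsub>T\<^esub> bracket T \<nu> (bracket T \<mu> \<tau>)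
        \<oplus>\<^bsub>T\<^esub> bracket T \<mu> (bracket T \<tau> \<nu>) = \<zero>\<^bsub>T\<^esub>"
    and anchor_bilinear: "bilinear_map k T A A (anchor T)"
    and anchor_bracket: "\<lbrakk>\<tau> \<in> carrier T; \<nu> \<in> carrier T; a \<in> carrier A\<rbrakk> \<Longrightarrow>
      anchor T (bracket T \<tau> \<nu>) a
        = anchor T \<tau> (anchor T \<nu> a) \<ominus>\<^bsub>A\<^esub> anchor T \<nu> (anchor T \<tau> a)"
    and anchor_deriv: "\<lbrakk>\<tau> \<in> carrier T; a \<in> carrier A; b \<in> carrier A\<rbrakk> \<Longrightarrow>
      anchor T \<tau> (a \<otimes>\<^bsub>A\<^esub> b) = anchor T \<tau> a \<otimes>\<^bsub>A\<^esub> b \<oplus>\<^bsub>A\<^esub> a \<otimes>\<^bsub>A\<^esub> anchor T \<tau> b"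
    and bracket_leibniz: "\<lbrakk>\<tau> \<in> carrier T; \<nu> \<in> carrier T; a \<in> carrier A\<rbrakk> \<Longrightarrow>
      bracket T \<tau> (a \<bullet>\<^bsub>T\<^esub> \<nu>) = a \<bullet>\<^bsub>T\<^esub> bracket T \<tau> \<nu> \<oplus>\<^bsub>T\<^esub> anchor T \<tau> a \<bullet>\<^bsub>T\<^esub> \<nu>"
    and anchor_amult: "\<lbrakk>\<tau> \<in> carrier T; a \<in> carrier A; b \<in> carrier A\<rbrakk> \<Longrightarrow>
      anchor T (a \<bullet>\<^bsub>T\<^esub> \<tau>) b = a \<otimes>\<^bsub>A\<^esub> anchor T \<tau> b"

text \<open>\<open>d\<close> is the derivation $\partial$; \<open>pair\<close> is the pairing on $T\oplus\Omega$, whose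
  elements are pairs, so that $\tau\in T$ is \<open>(\<tau>, 0)\<close> and $\omega\in\Omega$ is \<open>(0, \<omega>)\<close>.\<close>

locale vertex_algebroid_data =
  fixes k :: "('k, 'r) ring_scheme"
    and A :: "('k, 'a, 'x) module_scheme"
    and T :: "('k, 'a, 't, 'y) lie_oid_scheme"
    and \<Omega> :: "('k, 'a, 't, 'w, 'z) lie_amodule_scheme"
    and d :: "'a \<Rightarrow> 'w"
    and \<gamma> :: "'a \<Rightarrow> 't \<Rightarrow> 'w"
    and pair :: "'t \<times> 'w \<Rightarrow> 't \<times> 'w \<Rightarrow> 'a"
    and c :: "'t \<Rightarrow> 't \<Rightarrow> 'w"
begin

abbreviation pair_TT :: "'t \<Rightarrow> 't \<Rightarrow> 'a"
  where "pair_TT \<tau> \<nu> \<equiv> pair (\<tau>, \<zero>\<^bsub>\<Omega>\<^esub>) (\<nu>, \<zero>\<^bsub>\<Omega>\<^esub>)"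

abbreviation pair_TW :: "'t \<Rightarrow> 'w \<Rightarrow> 'a"
  where "pair_TW \<tau> \<omega> \<equiv> pair (\<tau>, \<zero>\<^bsub>\<Omega>\<^esub>) (\<zero>\<^bsub>T\<^esub>, \<omega>)"

abbreviation pair_WT :: "'w \<Rightarrow> 't \<Rightarrow> 'a"
  where "pair_WT \<omega> \<tau> \<equiv> pair (\<zero>\<^bsub>T\<^esub>, \<omega>) (\<tau>, \<zero>\<^bsub>\<Omega>\<^esub>)"

definition d_Lie :: "'t \<Rightarrow> 't \<Rightarrow> 't \<Rightarrow> 'w"
  where "d_Lie \<tau>\<^sub>1 \<tau>\<^sub>2 \<tau>\<^sub>3 =
    lie_act \<Omega> \<tau>\<^sub>1 (c \<tau>\<^sub>2 \<tau>\<^sub>3) \<ominus>\<^bsub>\<Omega>\<^esub> lie_act \<Omega> \<tau>\<^sub>2 (c \<tau>\<^sub>1 \<tau>\<^sub>3) \<oplus>\<^bsub>\<Omega>\<^esub> lie_act \<Omega> \<tau>\<^sub>3 (c \<tau>\<^sub>1 \<tau>\<^sub>2)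
      \<ominus>\<^bsub>\<Omega>\<^esub> c (bracket T \<tau>\<^sub>1 \<tau>\<^sub>2) \<tau>\<^sub>3 \<oplus>\<^bsub>\<Omega>\<^esub> c (bracket T \<tau>\<^sub>1 \<tau>\<^sub>3) \<tau>\<^sub>2 \<ominus>\<^bsub>\<Omega>\<^esub> c (bracket T \<tau>\<^sub>2 \<tau>\<^sub>3) \<tau>\<^sub>1"

end

locale vertex_algebroid = vertex_algebroid_data k A T \<Omega> d \<gamma> pair c
  for k :: "('k, 'r) ring_scheme"
    and A :: "('k, 'a, 'x) module_scheme"
    and T :: "('k, 'a, 't, 'y) lie_oid_scheme"
    and \<Omega> :: "('k, 'a, 't, 'w, 'z) lie_amodule_scheme"
    and d :: "'a \<Rightarrow> 'w"
    and \<gamma> :: "'a \<Rightarrow> 't \<Rightarrow> 'w"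
    and pair :: "'t \<times> 'w \<Rightarrow> 't \<times> 'w \<Rightarrow> 'a"
    and c :: "'t \<Rightarrow> 't \<Rightarrow> 'w" +
  assumes k_cring: "cring k"
    and k_half: "\<one>\<^bsub>k\<^esub> \<oplus>\<^bsub>k\<^esub> \<one>\<^bsub>k\<^esub> \<in> Units k"
    and A_algebra: "algebra k A"
    and T_lie_algebroid: "lie_algebroid k A T"
    and W_amodule: "is_amodule k A \<Omega>"
    and lie_act_bilinear: "bilinear_map k T \<Omega> \<Omega> (lie_act \<Omega>)"
    and lie_act_bracket: "\<lbrakk>\<tau> \<in> carrier T; \<nu> \<in> carrier T; \<omega> \<in> carrier \<Omega>\<rbrakk> \<Longrightarrow>
      lie_act \<Omega> (bracket T \<tau> \<nu>) \<omega>
        = lie_act \<Omega> \<tau> (lie_act \<Omega> \<nu> \<omega>) \<ominus>\<^bsub>\<Omega>\<^esub> lie_act \<Omega> \<nu> (lie_act \<Omega> \<tau> \<omega>)"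
    and d_linear: "linear_map k A \<Omega> d"
    and d_deriv: "\<lbrakk>a \<in> carrier A; b \<in> carrier A\<rbrakk> \<Longrightarrow>
      d (a \<otimes>\<^bsub>A\<^esub> b) = a \<bullet>\<^bsub>\<Omega>\<^esub> d b \<oplus>\<^bsub>\<Omega>\<^esub> b \<bullet>\<^bsub>\<Omega>\<^esub> d a"
    and d_lie_act: "\<lbrakk>\<tau> \<in> carrier T; a \<in> carrier A\<rbrakk> \<Longrightarrow> d (anchor T \<tau> a) = lie_act \<Omega> \<tau> (d a)"
    and pair_bilinear: "bilinear_map k (direct_sum T \<Omega>) (direct_sum T \<Omega>) A pair"
    and pair_sym: "\<lbrakk>u \<in> carrier (direct_sum T \<Omega>); v \<in> carrier (direct_sum T \<Omega>)\<rbrakk> \<Longrightarrow> pair u v = pair v u"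
    and pair_WW: "\<lbrakk>\<omega> \<in> carrier \<Omega>; \<omega>' \<in> carrier \<Omega>\<rbrakk> \<Longrightarrow> pair (\<zero>\<^bsub>T\<^esub>, \<omega>) (\<zero>\<^bsub>T\<^esub>, \<omega>') = \<zero>\<^bsub>A\<^esub>"
    and pair_amult_left: "\<lbrakk>a \<in> carrier A; \<tau> \<in> carrier T; \<omega> \<in> carrier \<Omega>\<rbrakk> \<Longrightarrow>
      pair_TW (a \<bullet>\<^bsub>T\<^esub> \<tau>) \<omega> = a \<otimes>\<^bsub>A\<^esub> pair_TW \<tau> \<omega>"
    and pair_amult_right: "\<lbrakk>a \<in> carrier A; \<tau> \<in> carrier T; \<omega> \<in> carrier \<Omega>\<rbrakk> \<Longrightarrow>
      pair_TW \<tau> (a \<bullet>\<^bsub>\<Omega>\<^esub> \<omega>) = a \<otimes>\<^bsub>A\<^esub> pair_TW \<tau> \<omega>"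
    and pair_d: "\<lbrakk>\<tau> \<in> carrier T; a \<in> carrier A\<rbrakk> \<Longrightarrow> pair_TW \<tau> (d a) = anchor T \<tau> a"
    and lie_act_amult: "\<lbrakk>\<tau> \<in> carrier T; a \<in> carrier A; \<omega> \<in> carrier \<Omega>\<rbrakk> \<Longrightarrow>
      lie_act \<Omega> \<tau> (a \<bullet>\<^bsub>\<Omega>\<^esub> \<omega>) = anchor T \<tau> a \<bullet>\<^bsub>\<Omega>\<^esub> \<omega> \<oplus>\<^bsub>\<Omega>\<^esub> a \<bullet>\<^bsub>\<Omega>\<^esub> lie_act \<Omega> \<tau> \<omega>"
    and amult_lie_act: "\<lbrakk>\<tau> \<in> carrier T; a \<in> carrier A; \<omega> \<in> carrier \<Omega>\<rbrakk> \<Longrightarrow>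
      lie_act \<Omega> (a \<bullet>\<^bsub>T\<^esub> \<tau>) \<omega> = a \<bullet>\<^bsub>\<Omega>\<^esub> lie_act \<Omega> \<tau> \<omega> \<oplus>\<^bsub>\<Omega>\<^esub> pair_TW \<tau> \<omega> \<bullet>\<^bsub>\<Omega>\<^esub> d a"
    and anchor_pair: "\<lbrakk>\<tau> \<in> carrier T; \<nu> \<in> carrier T; \<omega> \<in> carrier \<Omega>\<rbrakk> \<Longrightarrow>
      anchor T \<tau> (pair_TW \<nu> \<omega>) = pair_TW (bracket T \<tau> \<nu>) \<omega> \<oplus>\<^bsub>A\<^esub> pair_TW \<nu> (lie_act \<Omega> \<tau> \<omega>)"
    and c_bilinear: "bilinear_map k T T \<Omega> c"
    and c_skew: "\<lbrakk>\<tau> \<in> carrier T; \<nu> \<in> carrier T\<rbrakk> \<Longrightarrow> c \<tau> \<nu> = \<ominus>\<^bsub>\<Omega>\<^esub> c \<nu> \<tau>"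
    and \<gamma>_bilinear: "bilinear_map k A T \<Omega> \<gamma>"
    and A1: "\<lbrakk>a \<in> carrier A; b \<in> carrier A; \<tau> \<in> carrier T\<rbrakk> \<Longrightarrow>
      \<gamma> a (b \<bullet>\<^bsub>T\<^esub> \<tau>) = \<gamma> (a \<otimes>\<^bsub>A\<^esub> b) \<tau> \<ominus>\<^bsub>\<Omega>\<^esub> a \<bullet>\<^bsub>\<Omega>\<^esub> \<gamma> b \<tau>
        \<ominus>\<^bsub>\<Omega>\<^esub> anchor T \<tau> a \<bullet>\<^bsub>\<Omega>\<^esub> d b \<ominus>\<^bsub>\<Omega>\<^esub> anchor T \<tau> b \<bullet>\<^bsub>\<Omega>\<^esub> d a"
    and A2: "\<lbrakk>a \<in> carrier A; \<tau>\<^sub>1 \<in> carrier T; \<tau>\<^sub>2 \<in> carrier T\<rbrakk> \<Longrightarrow>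
      pair_TT (a \<bullet>\<^bsub>T\<^esub> \<tau>\<^sub>1) \<tau>\<^sub>2
        = a \<otimes>\<^bsub>A\<^esub> pair_TT \<tau>\<^sub>1 \<tau>\<^sub>2 \<oplus>\<^bsub>A\<^esub> pair_WT (\<gamma> a \<tau>\<^sub>1) \<tau>\<^sub>2 \<ominus>\<^bsub>A\<^esub> anchor T \<tau>\<^sub>1 (anchor T \<tau>\<^sub>2 a)"
    and A3: "\<lbrakk>a \<in> carrier A; \<tau>\<^sub>1 \<in> carrier T; \<tau>\<^sub>2 \<in> carrier T\<rbrakk> \<Longrightarrow>
      c (a \<bullet>\<^bsub>T\<^esub> \<tau>\<^sub>1) \<tau>\<^sub>2
        = a \<bullet>\<^bsub>\<Omega>\<^esub> c \<tau>\<^sub>1 \<tau>\<^sub>2 \<oplus>\<^bsub>\<Omega>\<^esub> \<gamma> a (bracket T \<tau>\<^sub>1 \<tau>\<^sub>2) \<ominus>\<^bsub>\<Omega>\<^esub> \<gamma> (anchor T \<tau>\<^sub>2 a) \<tau>\<^sub>1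
          \<oplus>\<^bsub>\<Omega>\<^esub> lie_act \<Omega> \<tau>\<^sub>2 (\<gamma> a \<tau>\<^sub>1)
          \<ominus>\<^bsub>\<Omega>\<^esub> half k \<odot>\<^bsub>\<Omega>\<^esub> (pair_TT \<tau>\<^sub>1 \<tau>\<^sub>2 \<bullet>\<^bsub>\<Omega>\<^esub> d a)
          \<oplus>\<^bsub>\<Omega>\<^esub> half k \<odot>\<^bsub>\<Omega>\<^esub> d (anchor T \<tau>\<^sub>1 (anchor T \<tau>\<^sub>2 a))
          \<ominus>\<^bsub>\<Omega>\<^esub> half k \<odot>\<^bsub>\<Omega>\<^esub> d (pair_TW \<tau>\<^sub>2 (\<gamma> a \<tau>\<^sub>1))"
    and A4: "\<lbrakk>\<tau>\<^sub>1 \<in> carrier T; \<tau>\<^sub>2 \<in> carrier T; \<tau>\<^sub>3 \<in> carrier T\<rbrakk> \<Longrightarrow>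
      pair_TT (bracket T \<tau>\<^sub>1 \<tau>\<^sub>2) \<tau>\<^sub>3 \<oplus>\<^bsub>A\<^esub> pair_TT \<tau>\<^sub>2 (bracket T \<tau>\<^sub>1 \<tau>\<^sub>3)
        = anchor T \<tau>\<^sub>1 (pair_TT \<tau>\<^sub>2 \<tau>\<^sub>3)
          \<ominus>\<^bsub>A\<^esub> half k \<odot>\<^bsub>A\<^esub> anchor T \<tau>\<^sub>2 (pair_TT \<tau>\<^sub>1 \<tau>\<^sub>3)
          \<ominus>\<^bsub>A\<^esub> half k \<odot>\<^bsub>A\<^esub> anchor T \<tau>\<^sub>3 (pair_TT \<tau>\<^sub>1 \<tau>\<^sub>2)
          \<oplus>\<^bsub>A\<^esub> pair_TW \<tau>\<^sub>2 (c \<tau>\<^sub>1 \<tau>\<^sub>3) \<oplus>\<^bsub>A\<^esub> pair_TW \<tau>\<^sub>3 (c \<tau>\<^sub>1 \<tau>\<^sub>2)"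
    and A5: "\<lbrakk>\<tau>\<^sub>1 \<in> carrier T; \<tau>\<^sub>2 \<in> carrier T; \<tau>\<^sub>3 \<in> carrier T\<rbrakk> \<Longrightarrow>
      d_Lie \<tau>\<^sub>1 \<tau>\<^sub>2 \<tau>\<^sub>3 = \<ominus>\<^bsub>\<Omega>\<^esub> (half k \<odot>\<^bsub>\<Omega>\<^esub> d
        (pair_TT (bracket T \<tau>\<^sub>1 \<tau>\<^sub>2) \<tau>\<^sub>3 \<oplus>\<^bsub>A\<^esub> pair_TT (bracket T \<tau>\<^sub>1 \<tau>\<^sub>3) \<tau>\<^sub>2
          \<ominus>\<^bsub>A\<^esub> pair_TT (bracket T \<tau>\<^sub>2 \<tau>\<^sub>3) \<tau>\<^sub>1
          \<ominus>\<^bsub>A\<^esub> anchor T \<tau>\<^sub>1 (pair_TT \<tau>\<^sub>2 \<tau>\<^sub>3) \<oplus>\<^bsub>A\<^esub> anchor T \<tau>\<^sub>2 (pair_TT \<tau>\<^sub>1 \<tau>\<^sub>3)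
          \<ominus>\<^bsub>A\<^esub> [(2::nat)] \<cdot>\<^bsub>A\<^esub> pair_TW \<tau>\<^sub>3 (c \<tau>\<^sub>1 \<tau>\<^sub>2)))"


section \<open>Graded vertex algebras\<close>

text \<open>\<open>grade V i\<close> is $V_i$, \<open>vac V\<close> is the vacuum and \<open>nprod V a n b\<close> is $a_{(n)}b$.\<close>

record ('k, 'v) va = "('k, 'v) module" +
  grade :: "nat \<Rightarrow> 'v set"
  vac :: 'v
  nprod :: "'v \<Rightarrow> int \<Rightarrow> 'v \<Rightarrow> 'v"

definition int_grade :: "('k, 'v, 'm) va_scheme \<Rightarrow> int \<Rightarrow> 'v set"
  where "int_grade V i = (if i \<ge> 0 then grade V (nat i) else {\<zero>\<^bsub>V\<^esub>})"

definition sgn_pow :: "int \<Rightarrow> int"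
  where "sgn_pow n = (if even n then 1 else - 1)"

text \<open>$\binom mj$ for $m \in \mathbb{Z}$, an integer: the division is exact. This is the
  defining formula of \<open>gbinomial\<close>, whose sort constraint excludes the integers here.\<close>

definition int_binom :: "int \<Rightarrow> nat \<Rightarrow> int"
  where "int_binom m j = (\<Prod>i = 0..<j. m - int i) div fact j"

text \<open>The sums in the Borcherds identity have finite support because \<open>nprod\<close> has degree
  $-n-1$ and the grading is bounded below.\<close>

locale graded_vertex_algebra =
  fixes k :: "('k, 'r) ring_scheme"
    and V :: "('k, 'v, 'm) va_scheme"
  assumes V_module: "module k V"
    and grade_submodule: "submodule (grade V i) k V"
    and grade_direct: "v \<in> carrier V \<Longrightarrow>
      \<exists>!f. (\<forall>i. f i \<in> grade V i) \<and> finite {i. f i \<noteq> \<zero>\<^bsub>V\<^esub>} \<and> v = supp_sum V f"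
    and vac_grade: "vac V \<in> grade V 0"
    and nprod_bilinear: "bilinear_map k V V V (\<lambda>a b. nprod V a n b)"
    and nprod_grade: "\<lbrakk>a \<in> grade V i; b \<in> grade V j\<rbrakk> \<Longrightarrow>
      nprod V a n b \<in> int_grade V (int i + int j - n - 1)"
    and vac_nprod: "a \<in> carrier V \<Longrightarrow> nprod V (vac V) n a = (if n = - 1 then a else \<zero>\<^bsub>V\<^esub>)"
    and nprod_vac: "a \<in> carrier V \<Longrightarrow> nprod V a (- 1) (vac V) = a"
    and nprod_vac_nonneg: "\<lbrakk>a \<in> carrier V; n \<ge> 0\<rbrakk> \<Longrightarrow> nprod V a n (vac V) = \<zero>\<^bsub>V\<^esub>"
    and borcherds: "\<lbrakk>a \<in> carrier V; b \<in> carrier V; c \<in> carrier V\<rbrakk> \<Longrightarrow>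
      supp_sum V (\<lambda>j. [int_binom m j] \<cdot>\<^bsub>V\<^esub> nprod V (nprod V a (n + int j) b) (m + l - int j) c)
      = supp_sum V (\<lambda>j. [((- 1) ^ j * int_binom n j)] \<cdot>\<^bsub>V\<^esub>
          (nprod V a (m + n - int j) (nprod V b (l + int j) c)
            \<ominus>\<^bsub>V\<^esub> [sgn_pow n] \<cdot>\<^bsub>V\<^esub> nprod V b (n + l - int j) (nprod V a (m + int j) c)))"

definition va_d :: "('k, 'v, 'm) va_scheme \<Rightarrow> 'v \<Rightarrow> 'v"
  where "va_d V a = nprod V a (- 2) (vac V)"

definition va_V1 :: "('k, 'v, 'm) va_scheme \<Rightarrow> ('k, 'v) module"
  where "va_V1 V =
    \<lparr>carrier = grade V 1, mult = undefined, one = undefined, zero = \<zero>\<^bsub>V\<^esub>,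
     add = add V, smult = smult V\<rparr>"

definition va_A :: "('k, 'v, 'm) va_scheme \<Rightarrow> ('k, 'v) module"
  where "va_A V =
    \<lparr>carrier = grade V 0, mult = (\<lambda>a b. nprod V a (- 1) b), one = vac V, zero = \<zero>\<^bsub>V\<^esub>,
     add = add V, smult = smult V\<rparr>"

definition va_Omega_set :: "('k, 'r) ring_scheme \<Rightarrow> ('k, 'v, 'm) va_scheme \<Rightarrow> 'v set"
  where "va_Omega_set k V =
    \<Inter> {H. submodule H k V \<and>
        {nprod V a (- 1) (va_d V b) | a b. a \<in> grade V 0 \<and> b \<in> grade V 0} \<subseteq> H}"

definition va_proj :: "('k, 'r) ring_scheme \<Rightarrow> ('k, 'v, 'm) va_scheme \<Rightarrow> 'v \<Rightarrow> 'v set"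
  where "va_proj k V x = va_Omega_set k V +>\<^bsub>va_V1 V\<^esub> x"

text \<open>An element of $T = V_1/\Omega$ is a coset, that is, the set of all $x\in V_1$ with
  $\pi(x) = \tau$. A map induced on the quotient takes the unique element of the image of the
  coset; \<open>the_elem\<close> is unspecified when the map depends on the representative.\<close>

definition va_T :: "('k, 'r) ring_scheme \<Rightarrow> ('k, 'v, 'm) va_scheme \<Rightarrow> ('k, 'v, 'v set) lie_oid"
  where "va_T k V =
    \<lparr>carrier = a_rcosets\<^bsub>va_V1 V\<^esub> (va_Omega_set k V), mult = undefined, one = undefined,
     zero = va_Omega_set k V,
     add = set_add (va_V1 V),
     smult = (\<lambda>r \<tau>. the_elem ((\<lambda>x. va_proj k V (r \<odot>\<^bsub>V\<^esub> x)) ` \<tau>)),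
     amult = (\<lambda>a \<tau>. the_elem ((\<lambda>x. va_proj k V (nprod V a (- 1) x)) ` \<tau>)),
     bracket = (\<lambda>\<tau> \<nu>. the_elem ((\<lambda>(x, y). va_proj k V (nprod V x 0 y)) ` (\<tau> \<times> \<nu>))),
     anchor = (\<lambda>\<tau> a. the_elem ((\<lambda>x. nprod V x 0 a) ` \<tau>))\<rparr>"

definition va_Omega ::
  "('k, 'r) ring_scheme \<Rightarrow> ('k, 'v, 'm) va_scheme \<Rightarrow> ('k, 'v, 'v set, 'v) lie_amodule"
  where "va_Omega k V =
    \<lparr>carrier = va_Omega_set k V, mult = undefined, one = undefined, zero = \<zero>\<^bsub>V\<^esub>,
     add = add V, smult = smult V,
     amult = (\<lambda>a \<omega>. nprod V a (- 1) \<omega>),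
     lie_act = (\<lambda>\<tau> \<omega>. the_elem ((\<lambda>x. nprod V x 0 \<omega>) ` \<tau>))\<rparr>"

definition va_bracket :: "('k, 'r) ring_scheme \<Rightarrow> ('k, 'v, 'm) va_scheme \<Rightarrow> 'v \<Rightarrow> 'v \<Rightarrow> 'v"
  where "va_bracket k V x y = half k \<odot>\<^bsub>V\<^esub> (nprod V x 0 y \<ominus>\<^bsub>V\<^esub> nprod V y 0 x)"

definition va_gamma ::
  "('k, 'r) ring_scheme \<Rightarrow> ('k, 'v, 'm) va_scheme \<Rightarrow> ('v set \<Rightarrow> 'v) \<Rightarrow> 'v \<Rightarrow> 'v set \<Rightarrow> 'v"
  where "va_gamma k V s a \<tau> = s (a \<bullet>\<^bsub>va_T k V\<^esub> \<tau>) \<ominus>\<^bsub>V\<^esub> nprod V a (- 1) (s \<tau>)"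

definition va_pair_TW :: "('k, 'v, 'm) va_scheme \<Rightarrow> 'v set \<Rightarrow> 'v \<Rightarrow> 'v"
  where "va_pair_TW V \<tau> \<omega> = the_elem ((\<lambda>x. nprod V x 1 \<omega>) ` \<tau>)"

text \<open>The symmetric biadditive extension to $T\oplus\Omega$ of the pairings on $T\times T$
  and $T\times\Omega$ and of the zero pairing on $\Omega\times\Omega$.\<close>

definition va_pair ::
  "('k, 'v, 'm) va_scheme \<Rightarrow> ('v set \<Rightarrow> 'v) \<Rightarrow> 'v set \<times> 'v \<Rightarrow> 'v set \<times> 'v \<Rightarrow> 'v"
  where "va_pair V s = (\<lambda>(\<tau>\<^sub>1, \<omega>\<^sub>1) (\<tau>\<^sub>2, \<omega>\<^sub>2).
    nprod V (s \<tau>\<^sub>1) 1 (s \<tau>\<^sub>2) \<oplus>\<^bsub>V\<^esub> va_pair_TW V \<tau>\<^sub>1 \<omega>\<^sub>2 \<oplus>\<^bsub>V\<^esub> va_pair_TW V \<tau>\<^sub>2 \<omega>\<^sub>1)"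

definition va_c ::
  "('k, 'r) ring_scheme \<Rightarrow> ('k, 'v, 'm) va_scheme \<Rightarrow> ('v set \<Rightarrow> 'v) \<Rightarrow> 'v set \<Rightarrow> 'v set \<Rightarrow> 'v"
  where "va_c k V s \<tau>\<^sub>1 \<tau>\<^sub>2 = s (bracket (va_T k V) \<tau>\<^sub>1 \<tau>\<^sub>2) \<ominus>\<^bsub>V\<^esub> va_bracket k V (s \<tau>\<^sub>1) (s \<tau>\<^sub>2)"

end

theory Submission
  imports Defs
begin

text \<open>All axioms are consequences of two special cases of the Borcherds identity: the
  commutator formula ($n = 0$) and the associator formula ($m = 0$, $n = -1$). In degrees
  $0$ and $1$ their sums have at most two terms. Applied to the vacuum, the commutator formula
  gives the skew symmetry $y_{(0)}x = \partial(x_{(1)}y) - x_{(0)}y$ and shows that $x_{(0)}$ is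
  a derivation; the associator formula expresses $(ab)x$, $(ax)_{(0)}y$ and $(ax)_{(1)}y$ through
  $a(bx)$, $a(x_{(0)}y)$, $a(x_{(1)}y)$ and correction terms, which are those of (A1)--(A3).
  Skew symmetry yields $c(\tau_1,\tau_2) = s([\tau_1,\tau_2]) - s(\tau_1)_{(0)}s(\tau_2)
  + \frac12\partial\langle\tau_1,\tau_2\rangle$, and with this form of $c$ the axioms become linear
  identities in $V$.\<close>

section \<open>Low-degree products in a graded vertex algebra\<close>

text \<open>On \<open>V_1\<close> the action of \<open>A\<close> need not be associative and the
  zeroth product need not be skew, but every such defect lies in Omega. Hence \<open>T\<close>
  carries honest structures. So does Omega itself, because its elements act as zero on
  \<open>A\<close> and on Omega. The same vanishing makes the operations on cosets, which are given
  through \<open>the_elem\<close>, independent of representatives, so it has to be known before an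
  axiom can be read as an equation in \<open>V\<close>. The splitting records what the quotient
  forgets: gamma measures how far \<open>s\<close> is from being \<open>A\<close>-linear, and
  \<open>c\<close> how far it is from respecting brackets. The symmetric part of the zeroth product
  of \<open>x\<close> and \<open>y\<close> is half of \<open>D (x \<diamondop> y)\<close>. The
  bracket used in \<open>c\<close> removes it, and all the halves in (A3)-(A5) go back to this one
  term.\<close>

lemma the_elem_image:
  assumes "x \<in> S" "\<And>y. y \<in> S \<Longrightarrow> f y = f x"
  shows "the_elem (f ` S) = f x"
proof -
  have "f ` S = (\<lambda>_. f x) ` S"
    using assms(2) by (rule image_cong[OF refl])
  then show ?thesis
    by (simp only: image_constant[OF assms(1)] the_elem_eq)
qed

locale gva = graded_vertex_algebra k V
  for k :: "('k, 'r) ring_scheme" and V :: "('k, 'v, 'm) va_scheme" (structure)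

sublocale gva \<subseteq> module k V
  by (rule V_module)

context gva
begin

abbreviation V0 :: "'v set" where "V0 \<equiv> grade V 0"
abbreviation V1 :: "'v set" where "V1 \<equiv> grade V 1"
abbreviation mul :: "'v \<Rightarrow> 'v \<Rightarrow> 'v" (infixr \<open>\<star>\<close> 75) where "a \<star> x \<equiv> nprod V a (- 1) x"
abbreviation act :: "'v \<Rightarrow> 'v \<Rightarrow> 'v" (infixr \<open>\<rhd>\<close> 75) where "x \<rhd> y \<equiv> nprod V x 0 y"
abbreviation ip :: "'v \<Rightarrow> 'v \<Rightarrow> 'v" (infixr \<open>\<diamondop>\<close> 75) where "x \<diamondop> y \<equiv> nprod V x 1 y"
abbreviation D :: "'v \<Rightarrow> 'v" where "D a \<equiv> va_d V a"

section \<open>Closure, bilinearity and degrees of the products\<close>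

lemma grade_carrier [simp, intro]: "x \<in> grade V i \<Longrightarrow> x \<in> carrier V"
  using submoduleE(1)[OF grade_submodule] by blast

lemma V0_carrier [simp]: "a \<in> V0 \<Longrightarrow> a \<in> carrier V"
  and V1_carrier [simp]: "x \<in> V1 \<Longrightarrow> x \<in> carrier V"
  by auto

lemma grade_closed [simp, intro]:
  "\<zero> \<in> grade V i"
  "x \<in> grade V i \<Longrightarrow> \<ominus> x \<in> grade V i"
  "\<lbrakk>x \<in> grade V i; y \<in> grade V i\<rbrakk> \<Longrightarrow> x \<oplus> y \<in> grade V i"
  "\<lbrakk>x \<in> grade V i; y \<in> grade V i\<rbrakk> \<Longrightarrow> x \<ominus> y \<in> grade V i"
  "\<lbrakk>r \<in> carrier k; x \<in> grade V i\<rbrakk> \<Longrightarrow> r \<odot> x \<in> grade V i"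
  using submoduleE[OF grade_submodule[of i]]
    subgroup.one_closed[OF submodule.axioms(1)[OF grade_submodule[of i]]]
  by (auto simp: a_minus_def)

lemma nprod_add_left:
  "\<lbrakk>x \<in> carrier V; y \<in> carrier V; z \<in> carrier V\<rbrakk> \<Longrightarrow> nprod V (x \<oplus> y) n z = nprod V x n z \<oplus> nprod V y n z"
  and nprod_add_right:
  "\<lbrakk>x \<in> carrier V; y \<in> carrier V; z \<in> carrier V\<rbrakk> \<Longrightarrow> nprod V z n (x \<oplus> y) = nprod V z n x \<oplus> nprod V z n y"
  and nprod_smult_left:
  "\<lbrakk>r \<in> carrier k; x \<in> carrier V; z \<in> carrier V\<rbrakk> \<Longrightarrow> nprod V (r \<odot> x) n z = r \<odot> nprod V x n z"
  and nprod_smult_right: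
  "\<lbrakk>r \<in> carrier k; x \<in> carrier V; z \<in> carrier V\<rbrakk> \<Longrightarrow> nprod V z n (r \<odot> x) = r \<odot> nprod V z n x"
  and nprod_closed [simp, intro]:
  "\<lbrakk>x \<in> carrier V; z \<in> carrier V\<rbrakk> \<Longrightarrow> nprod V x n z \<in> carrier V"
  using nprod_bilinear[of n] by (auto simp: bilinear_map_def linear_map_def)

lemma nprod_zero [simp]:
  assumes "z \<in> carrier V"
  shows "nprod V \<zero> n z = \<zero>" "nprod V z n \<zero> = \<zero>"
  using nprod_smult_left[of "\<zero>\<^bsub>k\<^esub>" \<zero> z n] nprod_smult_right[of "\<zero>\<^bsub>k\<^esub>" \<zero> z n] assms by auto

lemma nprod_minus_left:
  assumes "x \<in> carrier V" "z \<in> carrier V"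
  shows "nprod V (\<ominus> x) n z = \<ominus> nprod V x n z"
  using nprod_add_left[of "\<ominus> x" x z n] assms by (simp add: l_neg minus_equality)

lemma nprod_minus_right:
  assumes "x \<in> carrier V" "z \<in> carrier V"
  shows "nprod V z n (\<ominus> x) = \<ominus> nprod V z n x"
  using nprod_add_right[of "\<ominus> x" x z n] assms by (simp add: l_neg minus_equality)

lemma nprod_diff_left:
  "\<lbrakk>x \<in> carrier V; y \<in> carrier V; z \<in> carrier V\<rbrakk> \<Longrightarrow> nprod V (x \<ominus> y) n z = nprod V x n z \<ominus> nprod V y n z"
  and nprod_diff_right:
  "\<lbrakk>x \<in> carrier V; y \<in> carrier V; z \<in> carrier V\<rbrakk> \<Longrightarrow> nprod V z n (x \<ominus> y) = nprod V z n x \<ominus> nprod V z n y"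
  by (simp_all add: a_minus_def nprod_add_left nprod_add_right nprod_minus_left nprod_minus_right)

lemmas nprod_linear = nprod_add_left nprod_add_right nprod_minus_left nprod_minus_right
  nprod_diff_left nprod_diff_right nprod_smult_left nprod_smult_right

text \<open>The target degree is a premise, so that using the rule leaves an arithmetic goal and
  \<open>int_grade\<close> does not reappear.\<close>

lemma nprod_degree:
  "\<lbrakk>a \<in> grade V i; b \<in> grade V j; int p = int i + int j - n - 1\<rbrakk> \<Longrightarrow> nprod V a n b \<in> grade V p"
  using nprod_grade[of a i b j n] by (metis int_grade_def nat_int of_nat_0_le_iff)

lemma nprod_low_degree:
  "\<lbrakk>a \<in> grade V i; b \<in> grade V j; int i + int j \<le> n\<rbrakk> \<Longrightarrow> nprod V a n b = \<zero>"
  using nprod_grade[of a i b j n] by (auto simp: int_grade_def split: if_splits)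

lemma vac_closed [simp, intro]: "vac V \<in> V0" "vac V \<in> carrier V"
  using vac_grade by auto

lemma degree_closed [simp, intro]:
  "\<lbrakk>a \<in> V0; b \<in> V0\<rbrakk> \<Longrightarrow> a \<star> b \<in> V0"
  "\<lbrakk>a \<in> V0; x \<in> V1\<rbrakk> \<Longrightarrow> a \<star> x \<in> V1"
  "\<lbrakk>a \<in> V0; x \<in> V1\<rbrakk> \<Longrightarrow> x \<star> a \<in> V1"
  "\<lbrakk>a \<in> V0; x \<in> V1\<rbrakk> \<Longrightarrow> x \<rhd> a \<in> V0"
  "\<lbrakk>a \<in> V0; x \<in> V1\<rbrakk> \<Longrightarrow> a \<rhd> x \<in> V0"
  "\<lbrakk>x \<in> V1; y \<in> V1\<rbrakk> \<Longrightarrow> x \<rhd> y \<in> V1"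
  "\<lbrakk>x \<in> V1; y \<in> V1\<rbrakk> \<Longrightarrow> x \<diamondop> y \<in> V0"
  "a \<in> V0 \<Longrightarrow> D a \<in> V1"
  by (auto simp: va_d_def intro: nprod_degree)

section \<open>Truncation of the Borcherds identity\<close>

lemma supp_sum_lessThan:
  assumes "\<And>j. f j \<in> carrier V" "\<And>j. j \<ge> N \<Longrightarrow> f j = \<zero>"
  shows "supp_sum V f = finsum V f {..<N}"
proof -
  have "j < N" if "f j \<noteq> \<zero>" for j
    using assms(2)[of j] that by (cases "j < N") auto
  then have "{j. f j \<noteq> \<zero>} \<subseteq> {..<N}" by auto
  then show ?thesis unfolding supp_sum_def
    using assms(1) by (intro add.finprod_mono_neutral_cong_left) auto
qed

lemma supp_sum_1:
  "\<lbrakk>\<And>j. f j \<in> carrier V; \<And>j. j \<ge> 1 \<Longrightarrow> f j = \<zero>\<rbrakk> \<Longrightarrow> supp_sum V f = f 0"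
  using supp_sum_lessThan[of f 1] by (simp add: lessThan_Suc)

lemma supp_sum_2:
  "\<lbrakk>\<And>j. f j \<in> carrier V; \<And>j. j \<ge> 2 \<Longrightarrow> f j = \<zero>\<rbrakk> \<Longrightarrow> supp_sum V f = f 0 \<oplus> f 1"
  using supp_sum_lessThan[of f 2] by (simp add: lessThan_Suc numeral_2_eq_2 a_comm)

lemma add_pow_int [simp]:
  "[(0 :: int)] \<cdot> x = \<zero>"
  "x \<in> carrier V \<Longrightarrow> [(1 :: int)] \<cdot> x = x"
  "x \<in> carrier V \<Longrightarrow> [(- 1 :: int)] \<cdot> x = \<ominus> x"
  using add.int_pow_neg[of x 1] add.int_pow_1[of x] by (simp_all add: add_pow_def)

lemma int_binom_simps [simp]:
  "int_binom m 0 = 1" "int_binom m (Suc 0) = m" "j > 0 \<Longrightarrow> int_binom 0 j = 0"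
  by (simp_all add: int_binom_def prod_zero[of "{0..<j}"] bexI[of _ 0])

text \<open>For \<open>n = -1\<close> the product in the numerator is
  \<open>(-1)^j * fact j\<close>. Thus all coefficients on the right side of the associator formula
  are 1.\<close>

lemma int_binom_minus_one: "(- 1) ^ j * int_binom (- 1) j = 1"
proof -
  have "(\<Prod>i = 0..<j. - 1 - int i) = (- 1) ^ j * fact j"
    by (induction j) (auto simp: algebra_simps)
  then show ?thesis by (simp add: int_binom_def power_mult_distrib[symmetric])
qed

text \<open>The factor \<open>int_binom 0 j\<close> leaves a single term on the right. The last
  premise cuts the left side after \<open>j = 1\<close>; it holds by degree whenever
  \<open>a\<close> and \<open>b\<close> have degree at most one.\<close>

lemma commutator:
  assumes "a \<in> carrier V" "b \<in> carrier V" "c \<in> carrier V" and "\<And>j::nat. j \<ge> 2 \<Longrightarrow> nprod V a (int j) b = \<zero>"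
  shows "nprod V (a \<rhd> b) (m + l) c \<oplus> [m] \<cdot> nprod V (a \<diamondop> b) (m + l - 1) c
    = nprod V a m (nprod V b l c) \<ominus> nprod V b l (nprod V a m c)"
proof -
  have "nprod V (a \<rhd> b) (m + l) c \<oplus> [m] \<cdot> nprod V (a \<diamondop> b) (m + l - 1) c =
    supp_sum V (\<lambda>j. [int_binom m j] \<cdot> nprod V (nprod V a (0 + int j) b) (m + l - int j) c)"
    using assms by (subst supp_sum_2) auto
  also have "\<dots> = nprod V a m (nprod V b l c) \<ominus> nprod V b l (nprod V a m c)"
    using assms by (subst borcherds, simp_all, subst supp_sum_1) (auto simp:  sgn_pow_def)
  finally show ?thesis .
qed

text \<open>Now \<open>int_binom 0 j\<close> leaves a single term on the left, and the two premises
  on vanishing cut the right side after \<open>j = 1\<close>. Since \<open>sgn_pow (- 1)\<close> is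
  negative, the subtracted products enter with a plus sign.\<close>

lemma associator:
  assumes "a \<in> carrier V" "b \<in> carrier V" "c \<in> carrier V"
    and "\<And>j::nat. j \<ge> 2 \<Longrightarrow> nprod V b (l + int j) c = \<zero>"
    and "\<And>j::nat. j \<ge> 2 \<Longrightarrow> nprod V a (int j) c = \<zero>"
  shows "nprod V (a \<star> b) l c
    = a \<star> nprod V b l c \<oplus> nprod V b (l - 1) (a \<rhd> c)
      \<oplus> (nprod V a (- 2) (nprod V b (l + 1) c) \<oplus> nprod V b (l - 2) (a \<diamondop> c))"
proof -
  have "nprod V (a \<star> b) l c =
    supp_sum V (\<lambda>j. [int_binom 0 j] \<cdot> nprod V (nprod V a (- 1 + int j) b) (0 + l - int j) c)"
    using assms by (subst supp_sum_1) auto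
  also have "\<dots> = a \<star> nprod V b l c \<oplus> nprod V b (l - 1) (a \<rhd> c)
      \<oplus> (nprod V a (- 2) (nprod V b (l + 1) c) \<oplus> nprod V b (l - 2) (a \<diamondop> c))"
    using assms by (subst borcherds, simp_all add: int_binom_minus_one, subst supp_sum_2)
      (auto simp: sgn_pow_def a_minus_def)
  finally show ?thesis .
qed

text \<open>Otherwise the simplifier turns \<open>grade V 1\<close> into \<open>grade V (Suc 0)\<close>.\<close>

declare One_nat_def [simp del]

lemma minus_zero [simp]: "\<ominus> \<zero> = \<zero>"
  by (rule minus_equality) simp_all

text \<open>These rules bring an equation into a form without subtraction, in which
  both sides are compared modulo associativity and commutativity.\<close>

lemma minus_solve:
  "\<lbrakk>p \<in> carrier V; q \<in> carrier V; r \<in> carrier V\<rbrakk> \<Longrightarrow> p \<ominus> q \<oplus> r = p \<oplus> r \<ominus> q"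
  "\<lbrakk>p \<in> carrier V; q \<in> carrier V; r \<in> carrier V\<rbrakk> \<Longrightarrow> r \<oplus> (p \<ominus> q) = r \<oplus> p \<ominus> q"
  "\<lbrakk>p \<in> carrier V; q \<in> carrier V; r \<in> carrier V\<rbrakk> \<Longrightarrow> p \<ominus> q \<ominus> r = p \<ominus> (q \<oplus> r)"
  "\<lbrakk>p \<in> carrier V; q \<in> carrier V; r \<in> carrier V\<rbrakk> \<Longrightarrow> r \<ominus> (p \<ominus> q) = r \<oplus> q \<ominus> p"
  "\<lbrakk>p \<in> carrier V; q \<in> carrier V; r \<in> carrier V\<rbrakk> \<Longrightarrow> p \<ominus> q = r \<longleftrightarrow> p = r \<oplus> q"
  "\<lbrakk>p \<in> carrier V; q \<in> carrier V; r \<in> carrier V\<rbrakk> \<Longrightarrow> r = p \<ominus> q \<longleftrightarrow> r \<oplus> q = p"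
  "p \<in> carrier V \<Longrightarrow> \<ominus> p = \<zero> \<ominus> p"
  using add.inv_solve_right[of r p q] add.inv_solve_right'[of r p q]
  by (auto simp: a_minus_def minus_add a_ac)

lemmas group_simps = minus_solve a_ac

section \<open>Consequences of the commutator formula\<close>

lemma mul_commute: "\<lbrakk>a \<in> V0; b \<in> V0\<rbrakk> \<Longrightarrow> a \<star> b = b \<star> a"
  using commutator[of a b "vac V" "- 1" "- 1"]
  by (simp add: nprod_low_degree[of _ 0 _ 0] nprod_vac group_simps)

lemma act_skew: "\<lbrakk>x \<in> V1; y \<in> V1\<rbrakk> \<Longrightarrow> y \<rhd> x = D (x \<diamondop> y) \<ominus> x \<rhd> y"
  using commutator[of x y "vac V" "- 1" 0]
  by (simp add: nprod_low_degree[of _ 1 _ 1] nprod_vac nprod_vac_nonneg va_d_def group_simps)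

lemma ip_commute: "\<lbrakk>x \<in> V1; y \<in> V1\<rbrakk> \<Longrightarrow> x \<diamondop> y = y \<diamondop> x"
  using commutator[of x y "vac V" "- 1" 1]
  by (simp add: nprod_low_degree[of _ 1 _ 1] nprod_vac nprod_vac_nonneg group_simps)

lemma function_act: "\<lbrakk>a \<in> V0; x \<in> V1\<rbrakk> \<Longrightarrow> a \<rhd> x = \<ominus> (x \<rhd> a)"
  using commutator[of a x "vac V" "- 1" 0]
  by (simp add: nprod_low_degree[of _ 0 _ 1] nprod_vac nprod_vac_nonneg a_minus_def)

lemma mul_function: "\<lbrakk>a \<in> V0; x \<in> V1\<rbrakk> \<Longrightarrow> x \<star> a = a \<star> x \<oplus> D (x \<rhd> a)"
  using commutator[of a x "vac V" "- 1" "- 1"]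
  by (simp add: nprod_low_degree[of _ 0 _ 1] nprod_vac va_d_def function_act nprod_linear group_simps)

lemma nprod_m2:
  assumes "a \<in> V0" "b \<in> V0"
  shows "nprod V a (- 2) b = b \<star> D a"
  using commutator[of a b "vac V" "- 2" "- 1"] assms
  by (simp add: group_simps nprod_low_degree[of _ 0 _ 0] nprod_vac va_d_def)

text \<open>The coefficient of \<open>x \<diamondop> y\<close> in the commutator formula is
  \<open>m = 0\<close>. Only \<open>x\<close> and \<open>y\<close> are restricted in degree, because
  the truncation does not involve \<open>z\<close>.\<close>

lemma act_nprod:
  assumes "x \<in> V1" "y \<in> V0 \<union> V1" "z \<in> carrier V"
  shows "x \<rhd> nprod V y n z = nprod V (x \<rhd> y) n z \<oplus> nprod V y n (x \<rhd> z)"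
proof -
  have "nprod V x (int j) y = \<zero>" if "j \<ge> 2" for j
    using assms that by (auto simp: nprod_low_degree[of _ 1 _ 1] nprod_low_degree[of _ 1 _ 0])
  moreover have "y \<in> carrier V" using assms by auto
  ultimately have "nprod V (x \<rhd> y) n z = x \<rhd> nprod V y n z \<ominus> nprod V y n (x \<rhd> z)"
    using commutator[of x y z 0 n] assms by simp
  with assms \<open>y \<in> carrier V\<close> show ?thesis by (simp add: group_simps)
qed

lemma act_D: "\<lbrakk>x \<in> V1; a \<in> V0\<rbrakk> \<Longrightarrow> x \<rhd> D a = D (x \<rhd> a)"
  by (simp add: va_d_def act_nprod nprod_vac_nonneg)

lemma ip_D: "\<lbrakk>x \<in> V1; a \<in> V0\<rbrakk> \<Longrightarrow> x \<diamondop> D a = x \<rhd> a"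
  using commutator[of x a "vac V" 1 "- 2"]
  by (simp add: nprod_low_degree[of _ 1 _ 0] nprod_vac nprod_vac_nonneg va_d_def group_simps)

text \<open>By \<open>ip_D\<close> and \<open>act_D\<close> the two terms of skew symmetry are both
  \<open>D (x \<rhd> a)\<close> and cancel.\<close>

lemma D_act: "\<lbrakk>x \<in> V1; a \<in> V0\<rbrakk> \<Longrightarrow> D a \<rhd> x = \<zero>"
  using act_skew[of x "D a"] by (simp add: act_D ip_D group_simps)

lemma D_act_function:
  assumes "a \<in> V0" "b \<in> V0"
  shows "D a \<rhd> b = \<zero>"
proof -
  \<comment> \<open>On the vacuum this product is \<open>D (b \<rhd> a)\<close>, and
    \<open>b \<rhd> a\<close> vanishes by degree.\<close>
  have "b \<rhd> D a = \<zero>"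
    using commutator[of b a "vac V" 0 "- 2"] assms
    by (simp add: nprod_low_degree[of _ 0 _ 0] nprod_vac nprod_vac_nonneg va_d_def group_simps)
  then show ?thesis using function_act[of b "D a"] assms minus_minus[of "D a \<rhd> b"] by simp
qed

section \<open>Consequences of the associator formula\<close>

lemma mul_assoc: "\<lbrakk>a \<in> V0; b \<in> V0; c \<in> V0\<rbrakk> \<Longrightarrow> (a \<star> b) \<star> c = a \<star> (b \<star> c)"
  using associator[of a b c "- 1"] by (simp add: nprod_low_degree[of _ 0 _ 0])

text \<open>The surplus terms, evaluated by \<open>nprod_m2\<close>, are the obstruction to
  \<open>V_1\<close> being an \<open>A\<close>-module. They are combinations of generators of Omega
  and reappear as the corrections in (A1).\<close>

lemma mul_mul:
  "\<lbrakk>a \<in> V0; b \<in> V0; x \<in> V1\<rbrakk> \<Longrightarrow>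
    (a \<star> b) \<star> x = a \<star> (b \<star> x) \<ominus> (x \<rhd> a) \<star> D b \<ominus> (x \<rhd> b) \<star> D a"
  using associator[of a b x "- 1"]
  by (simp add: nprod_low_degree[of _ 0 _ 1] function_act nprod_linear nprod_m2 group_simps)

text \<open>The associator formula produces \<open>x \<star> (a \<rhd> y)\<close>, with the function
  on the right. Moving it to the left by \<open>mul_function\<close> costs the last term, the source
  of the second derivative of \<open>a\<close> in (A3).\<close>

lemma mul_act:
  assumes "a \<in> V0" "x \<in> V1" "y \<in> V1"
  shows "(a \<star> x) \<rhd> y = a \<star> (x \<rhd> y) \<oplus> (x \<diamondop> y) \<star> D a \<ominus> (y \<rhd> a) \<star> x \<ominus> D (x \<rhd> y \<rhd> a)"
proof -
  have 1: "x \<star> (a \<rhd> y) = \<ominus> ((y \<rhd> a) \<star> x \<oplus> D (x \<rhd> y \<rhd> a))"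
    using assms by (simp add: function_act mul_function[of "y \<rhd> a" x] nprod_minus_right)
  have 2: "nprod V a (- 2) (x \<diamondop> y) = (x \<diamondop> y) \<star> D a"
    using assms by (simp only: nprod_m2 degree_closed)
  show ?thesis
    using associator[of a x y 0] assms
    by (simp add: nprod_low_degree[of _ 0 _ 1] nprod_low_degree[of _ 1 _ 1] 1 2 group_simps)
qed

lemma mul_act_function:
  "\<lbrakk>a \<in> V0; x \<in> V1; b \<in> V0\<rbrakk> \<Longrightarrow> (a \<star> x) \<rhd> b = a \<star> (x \<rhd> b)"
  using associator[of a x b 0]
  by (simp add: nprod_low_degree[of _ 0 _ 0] nprod_low_degree[of _ 1 _ 0])

lemma mul_ip:
  "\<lbrakk>a \<in> V0; x \<in> V1; y \<in> V1\<rbrakk> \<Longrightarrow> (a \<star> x) \<diamondop> y = a \<star> (x \<diamondop> y) \<ominus> x \<rhd> y \<rhd> a"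
  using associator[of a x y 1]
  by (simp add: nprod_low_degree[of _ 0 _ 1] nprod_low_degree[of _ 1 _ 1] function_act
      nprod_linear group_simps)

lemma D_mul: "\<lbrakk>a \<in> V0; b \<in> V0\<rbrakk> \<Longrightarrow> D (a \<star> b) = a \<star> D b \<oplus> b \<star> D a"
  using associator[of a b "vac V" "- 2"]
  by (simp add: nprod_vac_nonneg nprod_vac nprod_m2 vac_nprod)

lemma D_linear:
  "\<lbrakk>a \<in> V0; b \<in> V0\<rbrakk> \<Longrightarrow> D (a \<oplus> b) = D a \<oplus> D b"
  "\<lbrakk>a \<in> V0; r \<in> carrier k\<rbrakk> \<Longrightarrow> D (r \<odot> a) = r \<odot> D a"
  "a \<in> V0 \<Longrightarrow> D (\<ominus> a) = \<ominus> D a"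
  "\<lbrakk>a \<in> V0; b \<in> V0\<rbrakk> \<Longrightarrow> D (a \<ominus> b) = D a \<ominus> D b"
  "D \<zero> = \<zero>"
  by (simp_all add: va_d_def nprod_linear)

section \<open>The module $\Omega$ and the quotient $T$\<close>

abbreviation Om :: "'v set" where "Om \<equiv> va_Omega_set k V"

lemma Omega_submodule: "submodule Om k V"
proof (rule submoduleI)
  show "Om \<subseteq> carrier V"
    using carrier_is_submodule unfolding va_Omega_set_def by (auto simp: va_d_def)
qed (auto simp: va_Omega_set_def submoduleE subgroup.one_closed[OF submodule.axioms(1), simplified])

lemma Omega_gen: "\<lbrakk>a \<in> V0; b \<in> V0\<rbrakk> \<Longrightarrow> a \<star> D b \<in> Om"
  unfolding va_Omega_set_def by blast

lemma Omega_least: "\<lbrakk>submodule H k V; \<And>a b. \<lbrakk>a \<in> V0; b \<in> V0\<rbrakk> \<Longrightarrow> a \<star> D b \<in> H; w \<in> Om\<rbrakk> \<Longrightarrow> w \<in> H"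
  unfolding va_Omega_set_def by blast

lemma Omega_V1 [simp]: "w \<in> Om \<Longrightarrow> w \<in> V1"
  by (rule Omega_least[OF grade_submodule]) auto

lemma Omega_closed [simp]:
  "\<zero> \<in> Om"
  "w \<in> Om \<Longrightarrow> \<ominus> w \<in> Om"
  "\<lbrakk>w \<in> Om; w' \<in> Om\<rbrakk> \<Longrightarrow> w \<oplus> w' \<in> Om"
  "\<lbrakk>w \<in> Om; w' \<in> Om\<rbrakk> \<Longrightarrow> w \<ominus> w' \<in> Om"
  "\<lbrakk>r \<in> carrier k; w \<in> Om\<rbrakk> \<Longrightarrow> r \<odot> w \<in> Om"
  using submoduleE[OF Omega_submodule] subgroup.one_closed[OF submodule.axioms(1)[OF Omega_submodule]]
  by (auto simp: a_minus_def)

lemma D_Omega [simp]: "a \<in> V0 \<Longrightarrow> D a \<in> Om"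
  using Omega_gen[of "vac V" a] by (simp add: vac_nprod)

text \<open>Omega is the least submodule containing the generators; closure under negation is the
  case of the scalar -1.\<close>

lemma Omega_induct [consumes 1, case_names gen zero add smult]:
  assumes "w \<in> Om"
    and gen: "\<And>a b. \<lbrakk>a \<in> V0; b \<in> V0\<rbrakk> \<Longrightarrow> P (a \<star> D b)"
    and zero: "P \<zero>"
    and add: "\<And>w w'. \<lbrakk>w \<in> Om; w' \<in> Om; P w; P w'\<rbrakk> \<Longrightarrow> P (w \<oplus> w')"
    and smult: "\<And>r w. \<lbrakk>r \<in> carrier k; w \<in> Om; P w\<rbrakk> \<Longrightarrow> P (r \<odot> w)"
  shows "P w"
proof -
  have "P (\<ominus> w)" if "w \<in> Om" "P w" for w
    using smult[of "\<ominus>\<^bsub>k\<^esub> \<one>\<^bsub>k\<^esub>" w] that by (simp add: smult_l_minus)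
  then have "submodule {w \<in> Om. P w} k V"
    by (intro submoduleI) (auto intro: zero add smult)
  then show ?thesis
    using Omega_least[of "{w \<in> Om. P w}" w] assms(1) by (auto intro: gen Omega_gen)
qed

lemma smult_r_diff:
  "\<lbrakk>r \<in> carrier k; x \<in> carrier V; y \<in> carrier V\<rbrakk> \<Longrightarrow> r \<odot> (x \<ominus> y) = r \<odot> x \<ominus> r \<odot> y"
  by (simp add: a_minus_def smult_r_distr smult_r_minus)

section \<open>Products with elements of Omega\<close>

lemma Omega_act_function [simp]: "\<lbrakk>w \<in> Om; b \<in> V0\<rbrakk> \<Longrightarrow> w \<rhd> b = \<zero>"
  by (induction w rule: Omega_induct)
    (simp_all add: mul_act_function D_act_function nprod_linear)

text \<open>The corrections in \<open>mul_mul\<close> contain \<open>w \<rhd> a\<close> and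
  \<open>w \<rhd> b\<close>, which are zero. This makes Omega an \<open>A\<close>-module.\<close>

lemma mul_mul_Omega: "\<lbrakk>a \<in> V0; b \<in> V0; w \<in> Om\<rbrakk> \<Longrightarrow> (a \<star> b) \<star> w = a \<star> (b \<star> w)"
  by (simp add: mul_mul group_simps)

lemma mul_Omega [simp]: "\<lbrakk>w \<in> Om; a \<in> V0\<rbrakk> \<Longrightarrow> a \<star> w \<in> Om"
proof (induction w rule: Omega_induct)
  case (gen b c)
  then show ?case using mul_mul_Omega[of a b "D c"] Omega_gen[of "a \<star> b" c] by simp
qed (simp_all add: nprod_linear)

lemma act_Omega [simp]: "\<lbrakk>w \<in> Om; x \<in> V1\<rbrakk> \<Longrightarrow> x \<rhd> w \<in> Om"
  by (induction w rule: Omega_induct) (simp_all add: nprod_linear act_nprod act_D)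

text \<open>By symmetry and \<open>ip_D\<close>, pairing \<open>w'\<close> with \<open>D b\<close>
  gives \<open>w' \<rhd> b\<close>, which is zero. This is what lets the pairing with Omega descend
  to \<open>T\<close>.\<close>

lemma ip_Omega_Omega [simp]:
  assumes "w \<in> Om" "w' \<in> Om"
  shows "w \<diamondop> w' = \<zero>"
  using assms(1)
proof (induction w rule: Omega_induct)
  case (gen a b)
  then show ?case using assms(2) by (simp add: mul_ip ip_commute[of "D b"] ip_D group_simps)
qed (use assms(2) in \<open>simp_all add: nprod_linear\<close>)

text \<open>Each term of \<open>mul_act\<close> on a generator contains a product already known to
  vanish. Hence the action on Omega descends to \<open>T\<close>.\<close>

lemma Omega_act_Omega [simp]:
  assumes "w \<in> Om" "w' \<in> Om"
  shows "w \<rhd> w' = \<zero>"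
  using assms(1)
proof (induction w rule: Omega_induct)
  case (gen a b)
  then show ?case using assms(2) by (simp add: mul_act D_act D_linear group_simps)
qed (use assms(2) in \<open>simp_all add: nprod_linear\<close>)

text \<open>Skew symmetry moves \<open>w\<close> to the right, up to a value of \<open>D\<close>.
  Together with \<open>act_Omega\<close> this makes Omega a two-sided ideal of \<open>V_1\<close>
  under the zeroth product, so that the bracket descends.\<close>

lemma Omega_act [simp]: "\<lbrakk>w \<in> Om; x \<in> V1\<rbrakk> \<Longrightarrow> w \<rhd> x \<in> Om"
  using act_skew[of x w] by simp

lemma mul_act_Omega:
  "\<lbrakk>a \<in> V0; x \<in> V1; w \<in> Om\<rbrakk> \<Longrightarrow> (a \<star> x) \<rhd> w = a \<star> (x \<rhd> w) \<oplus> (x \<diamondop> w) \<star> D a"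
  by (simp add: mul_act D_linear group_simps)

lemma mul_ip_Omega: "\<lbrakk>a \<in> V0; x \<in> V1; w \<in> Om\<rbrakk> \<Longrightarrow> (a \<star> x) \<diamondop> w = a \<star> (x \<diamondop> w)"
  by (simp add: mul_ip group_simps)

lemma ip_mul_Omega: "\<lbrakk>a \<in> V0; x \<in> V1; w \<in> Om\<rbrakk> \<Longrightarrow> x \<diamondop> (a \<star> w) = a \<star> (x \<diamondop> w)"
  by (simp add: ip_commute[of x] mul_ip group_simps)

section \<open>Cosets and the induced operations on representatives\<close>

abbreviation proj :: "'v \<Rightarrow> 'v set" where "proj x \<equiv> va_proj k V x"

lemma proj_def: "proj x = (\<lambda>w. w \<oplus> x) ` Om"
  by (auto simp: va_proj_def a_r_coset_def' va_V1_def)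

lemma proj_eq_iff:
  assumes "x \<in> V1" "y \<in> V1"
  shows "proj x = proj y \<longleftrightarrow> x \<ominus> y \<in> Om"
proof
  assume "proj x = proj y"
  moreover have "x \<in> proj x"
    using assms by (force simp: proj_def image_iff intro: bexI[of _ \<zero>])
  ultimately obtain w where "w \<in> Om" "x = w \<oplus> y"
    by (auto simp: proj_def)
  then show "x \<ominus> y \<in> Om"
    using assms by (simp add: a_minus_def a_assoc r_neg)
next
  assume *: "x \<ominus> y \<in> Om"
  have "proj x \<subseteq> proj y" if "x \<ominus> y \<in> Om" "x \<in> V1" "y \<in> V1" for x y
  proof
    fix z assume "z \<in> proj x"
    then obtain w where w: "w \<in> Om" "z = w \<oplus> x" by (auto simp: proj_def)
    then have "z = (w \<oplus> (x \<ominus> y)) \<oplus> y"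
      using that by (simp add: group_simps)
    then show "z \<in> proj y"
      using that w by (auto simp: proj_def)
  qed
  moreover have "y \<ominus> x \<in> Om"
    using Omega_closed(2)[OF *] assms by (simp add: group_simps)
  ultimately show "proj x = proj y"
    using * assms by blast
qed

lemma proj_add_Omega: "\<lbrakk>w \<in> Om; x \<in> V1\<rbrakk> \<Longrightarrow> proj (w \<oplus> x) = proj x"
  by (simp add: proj_eq_iff a_minus_def a_assoc r_neg)

lemma the_elem_proj:
  assumes "x \<in> V1" "\<And>w. w \<in> Om \<Longrightarrow> f (w \<oplus> x) = f x"
  shows "the_elem (f ` proj x) = f x"
proof (rule the_elem_image)
  show "x \<in> proj x"
    using assms by (force simp: proj_def image_iff intro: bexI[of _ \<zero>])
qed (use assms(2) in \<open>auto simp: proj_def\<close>)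

lemma carrier_T: "carrier (va_T k V) = proj ` V1"
  by (auto simp: va_T_def A_RCOSETS_def' va_proj_def va_V1_def)

lemma zero_T: "\<zero>\<^bsub>va_T k V\<^esub> = proj \<zero>"
  by (auto simp: va_T_def proj_def)

lemma add_T:
  assumes "x \<in> V1" "y \<in> V1"
  shows "proj x \<oplus>\<^bsub>va_T k V\<^esub> proj y = proj (x \<oplus> y)"
proof -
  have T: "proj x \<oplus>\<^bsub>va_T k V\<^esub> proj y = (\<Union>w\<in>Om. \<Union>w'\<in>Om. {w \<oplus> x \<oplus> (w' \<oplus> y)})"
    by (auto simp: va_T_def set_add_def' va_V1_def proj_def)
  show ?thesis
  proof (intro equalityI subsetI)
    fix z assume "z \<in> proj x \<oplus>\<^bsub>va_T k V\<^esub> proj y"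
    then obtain w w' where w: "w \<in> Om" "w' \<in> Om" "z = w \<oplus> x \<oplus> (w' \<oplus> y)"
      unfolding T by blast
    then have "z = (w \<oplus> w') \<oplus> (x \<oplus> y)"
      using assms by (simp add: a_ac)
    then show "z \<in> proj (x \<oplus> y)"
      using w by (auto simp: proj_def)
  next
    fix z assume "z \<in> proj (x \<oplus> y)"
    then obtain w where w: "w \<in> Om" "z = w \<oplus> (x \<oplus> y)"
      by (auto simp: proj_def)
    then have "z = w \<oplus> x \<oplus> (\<zero> \<oplus> y)"
      using assms by (simp add: a_ac)
    then show "z \<in> proj x \<oplus>\<^bsub>va_T k V\<^esub> proj y"
      unfolding T using w(1) Omega_closed(1) by blast
  qed
qed

lemma smult_T: "\<lbrakk>r \<in> carrier k; x \<in> V1\<rbrakk> \<Longrightarrow> r \<odot>\<^bsub>va_T k V\<^esub> proj x = proj (r \<odot> x)"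
  by (simp add: va_T_def, rule the_elem_proj) (simp_all add: smult_r_distr proj_add_Omega)

lemma amult_T: "\<lbrakk>a \<in> V0; x \<in> V1\<rbrakk> \<Longrightarrow> a \<bullet>\<^bsub>va_T k V\<^esub> proj x = proj (a \<star> x)"
  by (simp add: va_T_def, rule the_elem_proj) (simp_all add: nprod_linear proj_add_Omega)

lemma anchor_T: "\<lbrakk>a \<in> V0; x \<in> V1\<rbrakk> \<Longrightarrow> anchor (va_T k V) (proj x) a = x \<rhd> a"
  by (simp add: va_T_def, rule the_elem_proj) (simp_all add: nprod_linear)

lemma lie_act_T: "\<lbrakk>w \<in> Om; x \<in> V1\<rbrakk> \<Longrightarrow> lie_act (va_Omega k V) (proj x) w = x \<rhd> w"
  by (simp add: va_Omega_def, rule the_elem_proj) (simp_all add: nprod_linear)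

lemma pair_TW: "\<lbrakk>w \<in> Om; x \<in> V1\<rbrakk> \<Longrightarrow> va_pair_TW V (proj x) w = x \<diamondop> w"
  by (simp add: va_pair_TW_def, rule the_elem_proj) (simp_all add: nprod_linear)

lemma bracket_T:
  assumes "x \<in> V1" "y \<in> V1"
  shows "bracket (va_T k V) (proj x) (proj y) = proj (x \<rhd> y)"
proof -
  have "the_elem ((\<lambda>(x, y). proj (x \<rhd> y)) ` (proj x \<times> proj y)) = (\<lambda>(x, y). proj (x \<rhd> y)) (x, y)"
  proof (rule the_elem_image)
    show "(x, y) \<in> proj x \<times> proj y"
      using assms by (force simp: proj_def image_iff intro: bexI[of _ \<zero>])
  next
    fix p assume "p \<in> proj x \<times> proj y"
    then obtain w w' where w: "w \<in> Om" "w' \<in> Om" "p = (w \<oplus> x, w' \<oplus> y)"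
      by (auto simp: proj_def)
    \<comment> \<open>The fourth product \<open>w \<rhd> w'\<close> is zero, and the two on the
      right lie in Omega.\<close>
    have "(w \<oplus> x) \<rhd> (w' \<oplus> y) \<ominus> x \<rhd> y = w \<rhd> y \<oplus> x \<rhd> w'"
      using assms w by (simp add: nprod_linear group_simps)
    then show "(\<lambda>(x, y). proj (x \<rhd> y)) p = (\<lambda>(x, y). proj (x \<rhd> y)) (x, y)"
      using assms w by (simp add: proj_eq_iff)
  qed
  then show ?thesis by (simp add: va_T_def)
qed

section \<open>The Lie algebroid $T$ and the module $\Omega$\<close>

context
  fixes N :: "('v, 'n) ring_scheme" and H :: "'v set"
  assumes H: "submodule H k V" and N: "carrier N = H" "add N = add V" "zero N = \<zero>"
begin

lemma submodule_abelian_group: "abelian_group N"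
proof (rule abelian_groupI)
  fix x assume "x \<in> carrier N"
  then show "\<exists>y\<in>carrier N. y \<oplus>\<^bsub>N\<^esub> x = \<zero>\<^bsub>N\<^esub>"
    using submoduleE[OF H] N by (intro bexI[of _ "\<ominus> x"]) (auto simp: l_neg)
qed (use submoduleE[OF H] N subgroup.one_closed[OF submodule.axioms(1)[OF H]]
      in \<open>auto simp: a_ac subset_eq\<close>)

text \<open>The inverse in \<open>N\<close> is taken relative to its own carrier, so agreement with
  \<open>V\<close> needs uniqueness of inverses. It allows all subtraction in \<open>A\<close> and
  Omega to be carried out in \<open>V\<close>.\<close>

lemma submodule_a_inv: "x \<in> H \<Longrightarrow> \<ominus>\<^bsub>N\<^esub> x = \<ominus> x"
  using submoduleE[OF H] N
  by (intro abelian_group.minus_equality[OF submodule_abelian_group]) (auto simp: l_neg subset_eq)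

lemma submodule_a_minus: "y \<in> H \<Longrightarrow> x \<ominus>\<^bsub>N\<^esub> y = x \<ominus> y"
  using submodule_a_inv[of y] N by (simp add: a_minus_def)

end

lemma A_simps [simp]:
  "carrier (va_A V) = V0" "x \<otimes>\<^bsub>va_A V\<^esub> y = x \<star> y" "\<one>\<^bsub>va_A V\<^esub> = vac V" "\<zero>\<^bsub>va_A V\<^esub> = \<zero>"
  "x \<oplus>\<^bsub>va_A V\<^esub> y = x \<oplus> y" "r \<odot>\<^bsub>va_A V\<^esub> x = r \<odot> x"
  by (simp_all add: va_A_def)

lemma Omega_simps [simp]:
  "carrier (va_Omega k V) = Om" "\<zero>\<^bsub>va_Omega k V\<^esub> = \<zero>" "x \<oplus>\<^bsub>va_Omega k V\<^esub> y = x \<oplus> y"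
  "r \<odot>\<^bsub>va_Omega k V\<^esub> x = r \<odot> x" "a \<bullet>\<^bsub>va_Omega k V\<^esub> x = a \<star> x"
  by (simp_all add: va_Omega_def)

lemma A_abelian_group: "abelian_group (va_A V)"
  by (rule submodule_abelian_group[OF grade_submodule]) (simp_all add: va_A_def)

lemma Omega_abelian_group:
  "abelian_group (va_Omega k V)" "abelian_group (as_module (va_Omega k V))"
  by (rule submodule_abelian_group[OF Omega_submodule]; simp add: va_Omega_def as_module_def)+

lemma A_minus [simp]: "y \<in> V0 \<Longrightarrow> x \<ominus>\<^bsub>va_A V\<^esub> y = x \<ominus> y"
  by (rule submodule_a_minus[OF grade_submodule]) (simp_all add: va_A_def)

lemma Omega_minus [simp]:
  "y \<in> Om \<Longrightarrow> x \<ominus>\<^bsub>va_Omega k V\<^esub> y = x \<ominus> y" "y \<in> Om \<Longrightarrow> \<ominus>\<^bsub>va_Omega k V\<^esub> y = \<ominus> y"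
  by (rule submodule_a_minus[OF Omega_submodule] submodule_a_inv[OF Omega_submodule];
      simp add: va_Omega_def)+

lemma A_double: "x \<in> V0 \<Longrightarrow> [(2 :: nat)] \<cdot>\<^bsub>va_A V\<^esub> x = x \<oplus> x"
  by (simp add: add_pow_def nat_pow_def numeral_2_eq_2)

lemma A_algebra: "algebra k (va_A V)"
proof (rule algebraI)
  show "cring (va_A V)"
    using A_abelian_group
    by (rule cringI, intro comm_monoidI)
      (auto simp: mul_assoc vac_nprod nprod_linear intro: mul_commute)
qed (auto simp: smult_l_distr smult_r_distr smult_assoc1 nprod_linear is_cring)

lemma Omega_amodule: "is_amodule k (va_A V) (va_Omega k V)"
  unfolding is_amodule_def
proof (intro conjI A_algebra)
  show "module k (va_Omega k V)"
    using Omega_abelian_group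
    by (intro moduleI) (auto simp: smult_l_distr smult_r_distr smult_assoc1 is_cring)
  show "module (va_A V) (as_module (va_Omega k V))"
    using A_algebra Omega_abelian_group
    by (intro moduleI)
      (auto simp: algebra.M_cring as_module_def va_Omega_def nprod_linear mul_mul_Omega vac_nprod)
qed (simp add: nprod_linear)

text \<open>Kept general in \<open>N\<close> because it serves both \<open>va_T k V\<close> and its
  reduct under \<open>as_module\<close>.\<close>

lemma T_abelian_group_generic:
  assumes N: "carrier N = proj ` V1" "add N = add (va_T k V)" "zero N = proj \<zero>"
  shows "abelian_group N"
proof (rule abelian_groupI)
  fix \<tau> assume "\<tau> \<in> carrier N"
  then obtain x where "x \<in> V1" "\<tau> = proj x" by (auto simp: N)
  then show "\<exists>\<nu>\<in>carrier N. \<nu> \<oplus>\<^bsub>N\<^esub> \<tau> = \<zero>\<^bsub>N\<^esub>"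
    by (intro bexI[of _ "proj (\<ominus> x)"]) (simp_all add: N add_T l_neg)
qed (auto simp: N add_T a_ac)

lemma T_amodule: "is_amodule k (va_A V) (va_T k V)"
  unfolding is_amodule_def
proof (intro conjI A_algebra)
  show "module k (va_T k V)"
    by (intro moduleI T_abelian_group_generic)
      (auto simp: carrier_T zero_T add_T smult_T smult_l_distr smult_r_distr smult_assoc1 is_cring)
  \<comment> \<open>This is the one module law that can fail on \<open>V_1\<close>; the corrections
    of \<open>mul_mul\<close> disappear in the quotient.\<close>
  have "proj ((a \<star> b) \<star> x) = proj (a \<star> (b \<star> x))" if "a \<in> V0" "b \<in> V0" "x \<in> V1" for a b x
  proof -
    have "(a \<star> b) \<star> x \<ominus> a \<star> (b \<star> x) = \<ominus> ((x \<rhd> a) \<star> D b \<oplus> (x \<rhd> b) \<star> D a)"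
      using that by (simp add: mul_mul group_simps)
    then show ?thesis using that by (simp add: proj_eq_iff)
  qed
  then show "module (va_A V) (as_module (va_T k V))"
    using A_algebra
    by (intro moduleI T_abelian_group_generic)
      (auto simp: algebra.M_cring as_module_def carrier_T zero_T add_T amult_T nprod_linear vac_nprod)
qed (auto simp: carrier_T smult_T amult_T nprod_linear)

text \<open>The derivation rule \<open>act_nprod\<close> at \<open>n = 0\<close> is the Leibniz form
  of the Jacobi identity. With \<open>z\<close> arbitrary it also gives the Lie actions on
  \<open>A\<close> and Omega.\<close>

lemma act_act: "\<lbrakk>x \<in> V1; y \<in> V1; z \<in> carrier V\<rbrakk> \<Longrightarrow> (x \<rhd> y) \<rhd> z = x \<rhd> (y \<rhd> z) \<ominus> y \<rhd> (x \<rhd> z)"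
  by (simp add: act_nprod[of x y] group_simps)

end

section \<open>Division by two and the Lie algebroid\<close>

locale gva_half = gva +
  assumes two_unit: "\<one>\<^bsub>k\<^esub> \<oplus>\<^bsub>k\<^esub> \<one>\<^bsub>k\<^esub> \<in> Units k"
begin

declare One_nat_def [simp del]

lemma half_closed [simp]: "half k \<in> carrier k"
  using two_unit by (simp add: half_def)

lemma half_add: "x \<in> carrier V \<Longrightarrow> half k \<odot> x \<oplus> half k \<odot> x = x"
proof -
  assume x: "x \<in> carrier V"
  have "half k \<odot> x \<oplus> half k \<odot> x = (half k \<oplus>\<^bsub>k\<^esub> half k) \<odot> x"
    using x by (simp add: smult_l_distr)
  also have "half k \<oplus>\<^bsub>k\<^esub> half k = half k \<otimes>\<^bsub>k\<^esub> (\<one>\<^bsub>k\<^esub> \<oplus>\<^bsub>k\<^esub> \<one>\<^bsub>k\<^esub>)"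
    by (simp add: R.r_distr)
  also have "\<dots> = \<one>\<^bsub>k\<^esub>"
    using two_unit by (simp add: half_def)
  finally show ?thesis using x by simp
qed

text \<open>Sorting a sum puts equal halves next to each other in front of a remainder; this variant
  of \<open>half_add\<close> merges them there.\<close>

lemma half_add_left:
  "\<lbrakk>x \<in> carrier V; r \<in> carrier V\<rbrakk> \<Longrightarrow> half k \<odot> x \<oplus> (half k \<odot> x \<oplus> r) = x \<oplus> r"
  using half_add[of x] by (simp add: a_assoc[symmetric])

lemma half_smult:
  "\<lbrakk>r \<in> carrier k; x \<in> carrier V\<rbrakk> \<Longrightarrow> half k \<odot> (r \<odot> x) = r \<odot> (half k \<odot> x)"
  by (simp add: smult_assoc1[symmetric] R.m_comm)

text \<open>Skew symmetry determines only twice this product, hence the division. It is needed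
  because the bracket has to be alternating.\<close>

lemma act_self: "x \<in> V1 \<Longrightarrow> x \<rhd> x = half k \<odot> D (x \<diamondop> x)"
proof -
  assume x: "x \<in> V1"
  have "half k \<odot> (x \<rhd> x \<oplus> x \<rhd> x) = half k \<odot> D (x \<diamondop> x)"
    using act_skew[of x x] x by (simp add: group_simps)
  then show ?thesis using x by (simp add: smult_r_distr half_add)
qed

lemma Lie_algebroid_T: "lie_algebroid k (va_A V) (va_T k V)"
proof (rule lie_algebroid.intro)
  show "bilinear_map k (va_T k V) (va_T k V) (va_T k V) (bracket (va_T k V))"
    by (auto simp: bilinear_map_def linear_map_def carrier_T bracket_T add_T smult_T nprod_linear)
  show "bilinear_map k (va_T k V) (va_A V) (va_A V) (anchor (va_T k V))"
    by (auto simp: bilinear_map_def linear_map_def carrier_T anchor_T add_T smult_T nprod_linear)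
next
  fix \<tau> assume "\<tau> \<in> carrier (va_T k V)"
  then obtain x where x: "x \<in> V1" "\<tau> = proj x" by (auto simp: carrier_T)
  moreover have "proj (x \<rhd> x) = proj \<zero>"
    using x by (simp add: proj_eq_iff act_self)
  ultimately show "bracket (va_T k V) \<tau> \<tau> = \<zero>\<^bsub>va_T k V\<^esub>"
    by (simp add: bracket_T zero_T)
next
  fix \<tau> \<nu> \<mu> assume "\<tau> \<in> carrier (va_T k V)" "\<nu> \<in> carrier (va_T k V)" "\<mu> \<in> carrier (va_T k V)"
  then obtain x y z where xyz: "x \<in> V1" "\<tau> = proj x" "y \<in> V1" "\<nu> = proj y" "z \<in> V1" "\<mu> = proj z"
    by (auto simp: carrier_T)
  \<comment> \<open>The Jacobi sum in \<open>V_1\<close> is a value of \<open>D\<close>, hence in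
    Omega. Subtracting zero gives the shape required by \<open>proj_eq_iff\<close>.\<close>
  have "x \<rhd> y \<rhd> z \<oplus> y \<rhd> z \<rhd> x \<oplus> z \<rhd> x \<rhd> y \<ominus> \<zero> = D (y \<rhd> (x \<diamondop> z)) \<oplus> D ((x \<rhd> y) \<diamondop> z)"
    using xyz by (simp add: act_skew[of x z] act_skew[of "x \<rhd> y" z] act_act nprod_linear act_D group_simps)
  then have "proj (x \<rhd> y \<rhd> z \<oplus> y \<rhd> z \<rhd> x \<oplus> z \<rhd> x \<rhd> y) = proj \<zero>"
    using xyz by (subst proj_eq_iff) simp_all
  then show "bracket (va_T k V) \<tau> (bracket (va_T k V) \<nu> \<mu>) \<oplus>\<^bsub>va_T k V\<^esub>
      bracket (va_T k V) \<nu> (bracket (va_T k V) \<mu> \<tau>) \<oplus>\<^bsub>va_T k V\<^esub>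
      bracket (va_T k V) \<mu> (bracket (va_T k V) \<tau> \<nu>) = \<zero>\<^bsub>va_T k V\<^esub>"
    using xyz by (simp add: bracket_T zero_T add_T)
next
  fix \<tau> \<nu> a assume "\<tau> \<in> carrier (va_T k V)" "\<nu> \<in> carrier (va_T k V)" "a \<in> carrier (va_A V)"
  then obtain x y where xy: "x \<in> V1" "\<tau> = proj x" "y \<in> V1" "\<nu> = proj y" "a \<in> V0"
    by (auto simp: carrier_T)
  show "anchor (va_T k V) (bracket (va_T k V) \<tau> \<nu>) a =
      anchor (va_T k V) \<tau> (anchor (va_T k V) \<nu> a) \<ominus>\<^bsub>va_A V\<^esub>
      anchor (va_T k V) \<nu> (anchor (va_T k V) \<tau> a)"
    using xy by (simp add: bracket_T anchor_T act_act)
  show "bracket (va_T k V) \<tau> (a \<bullet>\<^bsub>va_T k V\<^esub> \<nu>) =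
      a \<bullet>\<^bsub>va_T k V\<^esub> bracket (va_T k V) \<tau> \<nu> \<oplus>\<^bsub>va_T k V\<^esub> anchor (va_T k V) \<tau> a \<bullet>\<^bsub>va_T k V\<^esub> \<nu>"
    using xy by (simp add: bracket_T anchor_T amult_T add_T act_nprod a_comm)
next
  fix \<tau> a b assume "\<tau> \<in> carrier (va_T k V)" "a \<in> carrier (va_A V)" "b \<in> carrier (va_A V)"
  then obtain x where x: "x \<in> V1" "\<tau> = proj x" "a \<in> V0" "b \<in> V0"
    by (auto simp: carrier_T)
  show "anchor (va_T k V) \<tau> (a \<otimes>\<^bsub>va_A V\<^esub> b) =
      anchor (va_T k V) \<tau> a \<otimes>\<^bsub>va_A V\<^esub> b \<oplus>\<^bsub>va_A V\<^esub> a \<otimes>\<^bsub>va_A V\<^esub> anchor (va_T k V) \<tau> b"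
    using x by (simp add: anchor_T act_nprod)
  show "anchor (va_T k V) (a \<bullet>\<^bsub>va_T k V\<^esub> \<tau>) b = a \<otimes>\<^bsub>va_A V\<^esub> anchor (va_T k V) \<tau> b"
    using x by (simp add: anchor_T amult_T mul_act_function)
qed (rule A_algebra T_amodule)+

end

section \<open>The vertex algebroid of a splitting\<close>

locale gva_split = gva_half +
  fixes s :: "'c set \<Rightarrow> 'c"
  assumes s_linear: "linear_map k (va_T k V) (va_V1 V) s"
    and s_section: "\<tau> \<in> carrier (va_T k V) \<Longrightarrow> proj (s \<tau>) = \<tau>"
begin

declare One_nat_def [simp del]

text \<open>The splitting carried over to elements: an idempotent endomorphism of \<open>V_1\<close>
  with kernel Omega and image \<open>s(T)\<close>.\<close>

abbreviation S :: "'c \<Rightarrow> 'c" where "S x \<equiv> s (proj x)"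

lemma S_V1 [simp]: "x \<in> V1 \<Longrightarrow> S x \<in> V1"
  using s_linear by (auto simp: linear_map_def carrier_T va_V1_def)

lemma proj_S [simp]: "x \<in> V1 \<Longrightarrow> proj (S x) = proj x"
  by (simp add: s_section carrier_T)

lemma S_add: "\<lbrakk>x \<in> V1; y \<in> V1\<rbrakk> \<Longrightarrow> S (x \<oplus> y) = S x \<oplus> S y"
  using s_linear by (auto simp: linear_map_def carrier_T va_V1_def add_T[symmetric])

lemma S_smult: "\<lbrakk>r \<in> carrier k; x \<in> V1\<rbrakk> \<Longrightarrow> S (r \<odot> x) = r \<odot> S x"
  using s_linear by (auto simp: linear_map_def carrier_T va_V1_def smult_T[symmetric])

lemma S_zero [simp]: "S \<zero> = \<zero>"
  using S_smult[of "\<zero>\<^bsub>k\<^esub>" \<zero>] by simp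

lemma S_Omega [simp]: "w \<in> Om \<Longrightarrow> S w = \<zero>"
  using proj_add_Omega[of w \<zero>] by simp

lemma S_diff:
  assumes "x \<in> V1" "y \<in> V1"
  shows "S (x \<ominus> y) = S x \<ominus> S y"
proof -
  have "x \<ominus> y \<oplus> y = x"
    using assms by (simp add: a_minus_def a_assoc l_neg)
  then have "S (x \<ominus> y) \<oplus> S y = S x"
    using S_add[of "x \<ominus> y" y] assms by simp
  then show ?thesis
    using assms by (simp add: group_simps)
qed

lemmas S_linear = S_add S_smult S_diff

lemma S_Omega_iff: "x \<in> V1 \<Longrightarrow> S x \<ominus> x \<in> Om"
  by (simp add: proj_eq_iff[symmetric])

text \<open>Choosing the representative \<open>s \<tau>\<close> makes \<open>s\<close> disappear on the arguments of an axiom.\<close>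

lemma T_cases:
  assumes "\<tau> \<in> carrier (va_T k V)"
  obtains x where "x \<in> V1" "\<tau> = proj x" "S x = x"
proof -
  obtain y where "y \<in> V1" "\<tau> = proj y" using assms by (auto simp: carrier_T)
  then show ?thesis using that[of "S y"] by simp
qed

lemma gamma_eq: "\<lbrakk>a \<in> V0; x \<in> V1\<rbrakk> \<Longrightarrow> va_gamma k V s a (proj x) = S (a \<star> x) \<ominus> a \<star> S x"
  by (simp add: va_gamma_def amult_T)

lemma gamma_Omega [simp]:
  assumes "a \<in> V0" "x \<in> V1"
  shows "S (a \<star> x) \<ominus> a \<star> S x \<in> Om"
proof -
  \<comment> \<open>Both differences in parentheses have the form \<open>S y \<ominus> y\<close>,
    and \<open>A\<close> preserves Omega.\<close>
  have "S (a \<star> x) \<ominus> a \<star> S x = (S (a \<star> x) \<ominus> a \<star> x) \<ominus> a \<star> (S x \<ominus> x)"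
    using assms by (simp add: nprod_linear group_simps)
  then show ?thesis
    using assms by (simp only: S_Omega_iff Omega_closed mul_Omega degree_closed)
qed

lemma c_eq:
  "\<lbrakk>x \<in> V1; y \<in> V1\<rbrakk> \<Longrightarrow> va_c k V s (proj x) (proj y)
    = S (x \<rhd> y) \<ominus> S x \<rhd> S y \<oplus> half k \<odot> D (S x \<diamondop> S y)"
  by (simp add: va_c_def va_bracket_def bracket_T act_skew[of "S x" "S y"] smult_r_diff smult_r_distr
      half_add half_add_left group_simps)

lemma c_Omega [simp]:
  assumes "x \<in> V1" "y \<in> V1"
  shows "S (x \<rhd> y) \<ominus> S x \<rhd> S y \<oplus> half k \<odot> D (S x \<diamondop> S y) \<in> Om"
proof -
  have "proj (x \<rhd> y) = proj (S x \<rhd> S y)"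
    using assms by (simp flip: bracket_T)
  then have "S (x \<rhd> y) \<ominus> S x \<rhd> S y \<in> Om"
    using assms S_Omega_iff[of "S x \<rhd> S y"] by simp
  then show ?thesis using assms by simp
qed

lemma pair_eq:
  "\<lbrakk>x \<in> V1; w \<in> Om; y \<in> V1; w' \<in> Om\<rbrakk> \<Longrightarrow>
    va_pair V s (proj x, w) (proj y, w') = S x \<diamondop> S y \<oplus> x \<diamondop> w' \<oplus> y \<diamondop> w"
  by (simp add: va_pair_def pair_TW)

section \<open>(A1)-(A5) on representatives fixed by \<open>S\<close>\<close>

lemmas structure_simps = zero_T add_T smult_T amult_T anchor_T lie_act_T bracket_T
  gamma_eq c_eq pair_eq

lemmas normalize = nprod_linear D_linear S_linear smult_r_distr smult_r_diff
  half_add half_add_left group_simps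

text \<open>As \<open>S\<close> kills the corrections of \<open>mul_mul\<close>, it does not
  distinguish \<open>(a \<star> b) \<star> x\<close> from \<open>a \<star> (b \<star> x)\<close>.
  The corrections survive only in the terms outside \<open>S\<close>, and this difference is
  (A1).\<close>

lemma gamma_amult:
  assumes "a \<in> V0" "b \<in> V0" "x \<in> V1" "S x = x"
  shows "va_gamma k V s a (b \<bullet>\<^bsub>va_T k V\<^esub> proj x)
    = va_gamma k V s (a \<star> b) (proj x) \<ominus> a \<star> va_gamma k V s b (proj x)
      \<ominus> anchor (va_T k V) (proj x) a \<star> D b \<ominus> anchor (va_T k V) (proj x) b \<star> D a"
  using assms by (simp add: structure_simps mul_mul normalize)

text \<open>For (A2), \<open>S (a \<star> x)\<close> is split into \<open>a \<star> x\<close> and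
  the value of gamma; \<open>mul_ip\<close> applied to the first part gives the second
  derivative.\<close>

lemma pair_amult:
  assumes "a \<in> V0" "x \<in> V1" "S x = x" "y \<in> V1" "S y = y"
  shows "va_pair V s (a \<bullet>\<^bsub>va_T k V\<^esub> proj x, \<zero>) (proj y, \<zero>)
    = a \<star> va_pair V s (proj x, \<zero>) (proj y, \<zero>) \<oplus> va_pair V s (proj \<zero>, va_gamma k V s a (proj x)) (proj y, \<zero>)
      \<ominus> anchor (va_T k V) (proj x) (anchor (va_T k V) (proj y) a)"
proof -
  have 1: "S (a \<star> x) \<ominus> a \<star> x \<in> Om"
    using gamma_Omega[of a x] assms by simp
  have 2: "y \<diamondop> (a \<star> x) = a \<star> (x \<diamondop> y) \<ominus> x \<rhd> y \<rhd> a"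
    using assms by (simp add: ip_commute[of y] mul_ip)
  show ?thesis
    \<comment> \<open>The pairing has to be unfolded while the value of gamma still has the form in
      fact \<open>1\<close>; expanding differences would hide that it lies in Omega.\<close>
    using assms by (simp add: structure_simps 1, simp add: 2 normalize, simp add: ip_commute)
qed

text \<open>For (A3), write \<open>S (a \<star> x)\<close> as \<open>a \<star> x \<oplus> g\<close>.
  Skew symmetry turns the \<open>g\<close> part of the product into \<open>y \<rhd> g\<close> and a
  full \<open>D (y \<diamondop> g)\<close>, of which \<open>c\<close> gives back one half. The other
  two halves arise likewise from the last terms of \<open>mul_act\<close> and
  \<open>mul_ip\<close>.\<close>

lemma c_amult:
  assumes "a \<in> V0" "x \<in> V1" "S x = x" "y \<in> V1" "S y = y"
  defines "g \<equiv> va_gamma k V s a (proj x)"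
  shows "va_c k V s (a \<bullet>\<^bsub>va_T k V\<^esub> proj x) (proj y)
    = a \<star> va_c k V s (proj x) (proj y)
      \<oplus> va_gamma k V s a (bracket (va_T k V) (proj x) (proj y))
      \<ominus> va_gamma k V s (anchor (va_T k V) (proj y) a) (proj x)
      \<oplus> lie_act (va_Omega k V) (proj y) g
      \<ominus> half k \<odot> (va_pair V s (proj x, \<zero>) (proj y, \<zero>) \<star> D a)
      \<oplus> half k \<odot> D (anchor (va_T k V) (proj x) (anchor (va_T k V) (proj y) a))
      \<ominus> half k \<odot> D (va_pair V s (proj y, \<zero>) (proj \<zero>, g))"
proof -
  have g: "g \<in> Om" "S (a \<star> x) = a \<star> x \<oplus> g"
    using gamma_Omega[of a x] assms by (simp_all add: g_def gamma_eq group_simps)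
  have 1: "g \<rhd> y = D (y \<diamondop> g) \<ominus> y \<rhd> g" "g \<diamondop> y = y \<diamondop> g"
    using assms(4) g(1) by (simp_all add: act_skew[of y g] ip_commute[of g y])
  have 2: "(a \<star> x) \<rhd> y = a \<star> (x \<rhd> y) \<oplus> (x \<diamondop> y) \<star> D a \<ominus> (y \<rhd> a) \<star> x \<ominus> D (x \<rhd> y \<rhd> a)"
    "(a \<star> x) \<diamondop> y = a \<star> (x \<diamondop> y) \<ominus> x \<rhd> y \<rhd> a"
    using assms by (simp_all add: mul_act mul_ip)
  show ?thesis
    using assms(1-5) g(1)
    by (simp add: structure_simps g(2) 1 2 D_mul normalize)
qed

text \<open>By \<open>ip_D\<close>, the \<open>D\<close> part of \<open>c\<close> contributes
  exactly the half terms of (A4), with opposite sign. What remains is invariance of the pairing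
  under \<open>x\<close>.\<close>

lemma pair_bracket:
  assumes "x \<in> V1" "S x = x" "y \<in> V1" "S y = y" "z \<in> V1" "S z = z"
  shows "va_pair V s (bracket (va_T k V) (proj x) (proj y), \<zero>) (proj z, \<zero>)
      \<oplus> va_pair V s (proj y, \<zero>) (bracket (va_T k V) (proj x) (proj z), \<zero>)
    = anchor (va_T k V) (proj x) (va_pair V s (proj y, \<zero>) (proj z, \<zero>))
      \<ominus> half k \<odot> anchor (va_T k V) (proj y) (va_pair V s (proj x, \<zero>) (proj z, \<zero>))
      \<ominus> half k \<odot> anchor (va_T k V) (proj z) (va_pair V s (proj x, \<zero>) (proj y, \<zero>))
      \<oplus> va_pair V s (proj y, \<zero>) (proj \<zero>, va_c k V s (proj x) (proj z))
      \<oplus> va_pair V s (proj z, \<zero>) (proj \<zero>, va_c k V s (proj x) (proj y))"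
proof -
  have 1: "x \<rhd> (y \<diamondop> z) = z \<diamondop> (x \<rhd> y) \<oplus> y \<diamondop> (x \<rhd> z)"
    using assms by (simp add: act_nprod ip_commute)
  have 2: "S (x \<rhd> y) \<diamondop> z = z \<diamondop> S (x \<rhd> y)"
    using assms by (simp add: ip_commute)
  have c: "S (x \<rhd> y) \<ominus> x \<rhd> y \<oplus> half k \<odot> D (x \<diamondop> y) \<in> Om" "S (x \<rhd> z) \<ominus> x \<rhd> z \<oplus> half k \<odot> D (x \<diamondop> z) \<in> Om"
    using c_Omega[of x y] c_Omega[of x z] assms by simp_all
  show ?thesis
    using assms by (simp add: structure_simps c, simp add: 1 2 ip_D normalize)
qed

text \<open>The terms of (A5) under \<open>S\<close> cancel by the Leibniz identity, since
  \<open>S\<close> kills values of \<open>D\<close>. Each of \<open>u\<close>, \<open>v\<close>,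
  \<open>t\<close> below occurs in both orders of the zeroth product; skew symmetry makes this a
  full \<open>D\<close> of a pairing, and \<open>c\<close> takes away one half. The remaining nested
  products add up to \<open>D (z \<diamondop> (x \<rhd> y))\<close> with a minus sign, which comes
  from \<open>p \<oplus> p\<close> on the right.\<close>

lemma d_Lie_c:
  assumes "x \<in> V1" "S x = x" "y \<in> V1" "S y = y" "z \<in> V1" "S z = z"
  defines "P \<equiv> \<lambda>\<tau> \<nu>. va_pair V s (\<tau>, \<zero>) (\<nu>, \<zero>)"
    and "c \<equiv> va_c k V s" and "br \<equiv> bracket (va_T k V)" and "la \<equiv> lie_act (va_Omega k V)"
    and "p \<equiv> va_pair V s (proj z, \<zero>) (proj \<zero>, va_c k V s (proj x) (proj y))"
  shows "la (proj x) (c (proj y) (proj z)) \<ominus> la (proj y) (c (proj x) (proj z))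
      \<oplus> la (proj z) (c (proj x) (proj y))
      \<ominus> c (br (proj x) (proj y)) (proj z) \<oplus> c (br (proj x) (proj z)) (proj y)
      \<ominus> c (br (proj y) (proj z)) (proj x)
    = \<ominus> (half k \<odot> D
        (P (br (proj x) (proj y)) (proj z) \<oplus> P (br (proj x) (proj z)) (proj y)
          \<ominus> P (br (proj y) (proj z)) (proj x)
          \<ominus> anchor (va_T k V) (proj x) (P (proj y) (proj z))
          \<oplus> anchor (va_T k V) (proj y) (P (proj x) (proj z))
          \<ominus> (p \<oplus> p)))"
proof -
  define u v t where "u = S (x \<rhd> y)" and "v = S (x \<rhd> z)" and "t = S (y \<rhd> z)"
  have uvt: "u \<in> V1" "v \<in> V1" "t \<in> V1" "S u = u" "S v = v" "S t = t"
    using assms(1-6) by (simp_all add: u_def v_def t_def)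
  have c: "u \<ominus> x \<rhd> y \<oplus> half k \<odot> D (x \<diamondop> y) \<in> Om" "v \<ominus> x \<rhd> z \<oplus> half k \<odot> D (x \<diamondop> z) \<in> Om"
    "t \<ominus> y \<rhd> z \<oplus> half k \<odot> D (y \<diamondop> z) \<in> Om"
    using c_Omega[of x y] c_Omega[of x z] c_Omega[of y z] assms(1-6)
    by (simp_all add: u_def v_def t_def)
  \<comment> \<open>Up to values of \<open>D\<close>, on which \<open>S\<close> vanishes, all nested products are combinations
    of two of them.\<close>
  have nested:
    "(x \<rhd> y) \<rhd> z = x \<rhd> y \<rhd> z \<ominus> y \<rhd> x \<rhd> z"
    "(x \<rhd> z) \<rhd> y = D (y \<diamondop> (x \<rhd> z)) \<ominus> y \<rhd> x \<rhd> z"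
    "(y \<rhd> z) \<rhd> x = D (x \<diamondop> (y \<rhd> z)) \<ominus> x \<rhd> y \<rhd> z"
    "z \<rhd> x \<rhd> y = D (z \<diamondop> (x \<rhd> y)) \<ominus> (x \<rhd> y \<rhd> z \<ominus> y \<rhd> x \<rhd> z)"
    using assms(1,3,5)
    by (simp_all add: act_skew[of y "x \<rhd> z"] act_skew[of x "y \<rhd> z"]
        act_skew[of "x \<rhd> y" z] ip_commute[of "x \<rhd> y" z] act_act[of x y z])
  have skew: "x \<rhd> t = D (x \<diamondop> t) \<ominus> t \<rhd> x" "y \<rhd> v = D (y \<diamondop> v) \<ominus> v \<rhd> y"
    "z \<rhd> u = D (z \<diamondop> u) \<ominus> u \<rhd> z" "t \<diamondop> x = x \<diamondop> t" "v \<diamondop> y = y \<diamondop> v" "u \<diamondop> z = z \<diamondop> u"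
    using assms(1,3,5) uvt
    by (simp_all add: act_skew[of t x] act_skew[of v y] act_skew[of u z]
        ip_commute[of t x] ip_commute[of v y] ip_commute[of u z])
  have cs: "c (proj x) (proj y) = u \<ominus> x \<rhd> y \<oplus> half k \<odot> D (x \<diamondop> y)"
    "c (proj x) (proj z) = v \<ominus> x \<rhd> z \<oplus> half k \<odot> D (x \<diamondop> z)"
    "c (proj y) (proj z) = t \<ominus> y \<rhd> z \<oplus> half k \<odot> D (y \<diamondop> z)"
    "c (proj (x \<rhd> y)) (proj z) = S ((x \<rhd> y) \<rhd> z) \<ominus> u \<rhd> z \<oplus> half k \<odot> D (u \<diamondop> z)"
    "c (proj (x \<rhd> z)) (proj y) = S ((x \<rhd> z) \<rhd> y) \<ominus> v \<rhd> y \<oplus> half k \<odot> D (v \<diamondop> y)"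
    "c (proj (y \<rhd> z)) (proj x) = S ((y \<rhd> z) \<rhd> x) \<ominus> t \<rhd> x \<oplus> half k \<odot> D (t \<diamondop> x)"
    using assms(1-6) by (simp_all add: c_def c_eq u_def v_def t_def)
  have Ps: "P (proj y) (proj z) = y \<diamondop> z" "P (proj x) (proj z) = x \<diamondop> z"
    "P (proj (x \<rhd> y)) (proj z) = u \<diamondop> z" "P (proj (x \<rhd> z)) (proj y) = v \<diamondop> y"
    "P (proj (y \<rhd> z)) (proj x) = t \<diamondop> x"
    using assms(1-6) by (simp_all add: P_def pair_eq u_def v_def t_def)
  have p: "p = z \<diamondop> u \<ominus> z \<diamondop> (x \<rhd> y) \<oplus> half k \<odot> (z \<rhd> (x \<diamondop> y))"
    using assms(1-6) uvt c by (simp add: p_def pair_eq cs[unfolded c_def], simp add: ip_D nprod_linear)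
  have br: "br (proj x) (proj y) = proj (x \<rhd> y)" "br (proj x) (proj z) = proj (x \<rhd> z)"
    "br (proj y) (proj z) = proj (y \<rhd> z)"
    using assms(1,3,5) by (simp_all add: br_def bracket_T)
  have la: "la (proj x) (t \<ominus> y \<rhd> z \<oplus> half k \<odot> D (y \<diamondop> z))
      = x \<rhd> t \<ominus> x \<rhd> y \<rhd> z \<oplus> half k \<odot> D (x \<rhd> (y \<diamondop> z))"
    "la (proj y) (v \<ominus> x \<rhd> z \<oplus> half k \<odot> D (x \<diamondop> z))
      = y \<rhd> v \<ominus> y \<rhd> x \<rhd> z \<oplus> half k \<odot> D (y \<rhd> (x \<diamondop> z))"
    "la (proj z) (u \<ominus> x \<rhd> y \<oplus> half k \<odot> D (x \<diamondop> y))
      = z \<rhd> u \<ominus> z \<rhd> x \<rhd> y \<oplus> half k \<odot> D (z \<rhd> (x \<diamondop> y))"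
    using assms(1,3,5) uvt c by (simp_all add: la_def lie_act_T, simp_all add: nprod_linear act_D)
  show ?thesis
    unfolding br cs la Ps p
    using assms(1,3,5) uvt by (simp add: anchor_T nested skew normalize)
qed

section \<open>Linearity and assembly of the vertex algebroid\<close>

lemma structure_maps_linear:
  "bilinear_map k (va_T k V) (va_Omega k V) (va_Omega k V) (lie_act (va_Omega k V))"
  "linear_map k (va_A V) (va_Omega k V) D"
  "bilinear_map k (va_A V) (va_T k V) (va_Omega k V) (va_gamma k V s)"
  "bilinear_map k (va_T k V) (va_T k V) (va_Omega k V) (va_c k V s)"
  "bilinear_map k (direct_sum (va_T k V) (va_Omega k V)) (direct_sum (va_T k V) (va_Omega k V))
    (va_A V) (va_pair V s)"
proof -
  show "bilinear_map k (va_T k V) (va_Omega k V) (va_Omega k V) (lie_act (va_Omega k V))"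
    by (auto simp: bilinear_map_def linear_map_def carrier_T lie_act_T add_T smult_T nprod_linear)
  show "linear_map k (va_A V) (va_Omega k V) D"
    by (auto simp: linear_map_def D_linear)
  show "bilinear_map k (va_A V) (va_T k V) (va_Omega k V) (va_gamma k V s)"
    by (auto simp: bilinear_map_def linear_map_def carrier_T structure_simps)
      (simp_all add: normalize)
  show "bilinear_map k (va_T k V) (va_T k V) (va_Omega k V) (va_c k V s)"
    by (auto simp: bilinear_map_def linear_map_def carrier_T structure_simps)
      (simp_all add: half_smult normalize)
  show "bilinear_map k (direct_sum (va_T k V) (va_Omega k V)) (direct_sum (va_T k V) (va_Omega k V))
      (va_A V) (va_pair V s)"
    by (auto simp: bilinear_map_def linear_map_def direct_sum_def carrier_T structure_simps)
      (simp_all add: normalize)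
qed

theorem vertex_algebroid_V:
  "vertex_algebroid k (va_A V) (va_T k V) (va_Omega k V) D (va_gamma k V s) (va_pair V s) (va_c k V s)"
proof (rule vertex_algebroid.intro)
  show "bilinear_map k (va_T k V) (va_Omega k V) (va_Omega k V) (lie_act (va_Omega k V))"
    "linear_map k (va_A V) (va_Omega k V) D"
    "bilinear_map k (va_A V) (va_T k V) (va_Omega k V) (va_gamma k V s)"
    "bilinear_map k (va_T k V) (va_T k V) (va_Omega k V) (va_c k V s)"
    "bilinear_map k (direct_sum (va_T k V) (va_Omega k V)) (direct_sum (va_T k V) (va_Omega k V))
      (va_A V) (va_pair V s)"
    by (rule structure_maps_linear)+
next
  fix \<tau> \<nu> w
  assume "\<tau> \<in> carrier (va_T k V)" "\<nu> \<in> carrier (va_T k V)" and w: "w \<in> carrier (va_Omega k V)"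
  then obtain x y where xy: "x \<in> V1" "\<tau> = proj x" "y \<in> V1" "\<nu> = proj y" by (auto simp: carrier_T)
  show "lie_act (va_Omega k V) (bracket (va_T k V) \<tau> \<nu>) w =
      lie_act (va_Omega k V) \<tau> (lie_act (va_Omega k V) \<nu> w) \<ominus>\<^bsub>va_Omega k V\<^esub>
      lie_act (va_Omega k V) \<nu> (lie_act (va_Omega k V) \<tau> w)"
    using xy w by (simp add: structure_simps act_act)
  show "anchor (va_T k V) \<tau> (va_pair V s (\<nu>, \<zero>\<^bsub>va_Omega k V\<^esub>) (\<zero>\<^bsub>va_T k V\<^esub>, w)) =
      va_pair V s (bracket (va_T k V) \<tau> \<nu>, \<zero>\<^bsub>va_Omega k V\<^esub>) (\<zero>\<^bsub>va_T k V\<^esub>, w) \<oplus>\<^bsub>va_A V\<^esub>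
      va_pair V s (\<nu>, \<zero>\<^bsub>va_Omega k V\<^esub>) (\<zero>\<^bsub>va_T k V\<^esub>, lie_act (va_Omega k V) \<tau> w)"
    using xy w by (simp add: structure_simps act_nprod)
next
  fix a b assume "a \<in> carrier (va_A V)" "b \<in> carrier (va_A V)"
  then show "D (a \<otimes>\<^bsub>va_A V\<^esub> b) = a \<bullet>\<^bsub>va_Omega k V\<^esub> D b \<oplus>\<^bsub>va_Omega k V\<^esub> b \<bullet>\<^bsub>va_Omega k V\<^esub> D a"
    by (simp add: D_mul)
next
  fix \<tau> a assume "\<tau> \<in> carrier (va_T k V)" and a: "a \<in> carrier (va_A V)"
  then obtain x where x: "x \<in> V1" "\<tau> = proj x" by (auto simp: carrier_T)
  show "D (anchor (va_T k V) \<tau> a) = lie_act (va_Omega k V) \<tau> (D a)"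
    using x a by (simp add: structure_simps act_D)
  show "va_pair V s (\<tau>, \<zero>\<^bsub>va_Omega k V\<^esub>) (\<zero>\<^bsub>va_T k V\<^esub>, D a) = anchor (va_T k V) \<tau> a"
    using x a by (simp add: structure_simps ip_D)
next
  fix u v
  assume "u \<in> carrier (direct_sum (va_T k V) (va_Omega k V))" "v \<in> carrier (direct_sum (va_T k V) (va_Omega k V))"
  then obtain x w y w' where "x \<in> V1" "w \<in> Om" "y \<in> V1" "w' \<in> Om" "u = (proj x, w)" "v = (proj y, w')"
    by (auto simp: direct_sum_def carrier_T)
  then show "va_pair V s u v = va_pair V s v u"
    by (simp add: pair_eq ip_commute[of "S x"] a_ac)
next
  fix w w' assume "w \<in> carrier (va_Omega k V)" "w' \<in> carrier (va_Omega k V)"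
  then show "va_pair V s (\<zero>\<^bsub>va_T k V\<^esub>, w) (\<zero>\<^bsub>va_T k V\<^esub>, w') = \<zero>\<^bsub>va_A V\<^esub>"
    by (simp add: structure_simps)
next
  fix a \<tau> w
  assume "a \<in> carrier (va_A V)" "\<tau> \<in> carrier (va_T k V)" "w \<in> carrier (va_Omega k V)"
  then obtain x where x: "a \<in> V0" "x \<in> V1" "\<tau> = proj x" "w \<in> Om" by (auto simp: carrier_T)
  show "va_pair V s (a \<bullet>\<^bsub>va_T k V\<^esub> \<tau>, \<zero>\<^bsub>va_Omega k V\<^esub>) (\<zero>\<^bsub>va_T k V\<^esub>, w) =
      a \<otimes>\<^bsub>va_A V\<^esub> va_pair V s (\<tau>, \<zero>\<^bsub>va_Omega k V\<^esub>) (\<zero>\<^bsub>va_T k V\<^esub>, w)"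
    using x by (simp add: structure_simps mul_ip_Omega)
  show "va_pair V s (\<tau>, \<zero>\<^bsub>va_Omega k V\<^esub>) (\<zero>\<^bsub>va_T k V\<^esub>, a \<bullet>\<^bsub>va_Omega k V\<^esub> w) =
      a \<otimes>\<^bsub>va_A V\<^esub> va_pair V s (\<tau>, \<zero>\<^bsub>va_Omega k V\<^esub>) (\<zero>\<^bsub>va_T k V\<^esub>, w)"
    using x by (simp add: structure_simps ip_mul_Omega)
  show "lie_act (va_Omega k V) \<tau> (a \<bullet>\<^bsub>va_Omega k V\<^esub> w) =
      anchor (va_T k V) \<tau> a \<bullet>\<^bsub>va_Omega k V\<^esub> w \<oplus>\<^bsub>va_Omega k V\<^esub> a \<bullet>\<^bsub>va_Omega k V\<^esub> lie_act (va_Omega k V) \<tau> w"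
    using x by (simp add: structure_simps act_nprod)
  show "lie_act (va_Omega k V) (a \<bullet>\<^bsub>va_T k V\<^esub> \<tau>) w =
      a \<bullet>\<^bsub>va_Omega k V\<^esub> lie_act (va_Omega k V) \<tau> w \<oplus>\<^bsub>va_Omega k V\<^esub>
      va_pair V s (\<tau>, \<zero>\<^bsub>va_Omega k V\<^esub>) (\<zero>\<^bsub>va_T k V\<^esub>, w) \<bullet>\<^bsub>va_Omega k V\<^esub> D a"
    using x by (simp add: structure_simps mul_act_Omega)
next
  fix \<tau> \<nu> assume "\<tau> \<in> carrier (va_T k V)" "\<nu> \<in> carrier (va_T k V)"
  then obtain x y where xy: "x \<in> V1" "\<tau> = proj x" "y \<in> V1" "\<nu> = proj y" by (auto simp: carrier_T)
  \<comment> \<open>The sum of \<open>S x \<rhd> S y\<close> and its mirror image is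
    \<open>D (S x \<diamondop> S y)\<close>, which the two halves cancel; \<open>S\<close> kills the
    corresponding \<open>D\<close> term.\<close>
  have "S (x \<rhd> y) \<ominus> S x \<rhd> S y \<oplus> half k \<odot> D (S x \<diamondop> S y)
      = \<ominus> (S (y \<rhd> x) \<ominus> S y \<rhd> S x \<oplus> half k \<odot> D (S y \<diamondop> S x))"
    using xy by (simp add: act_skew[of x y] act_skew[of "S x" "S y"] ip_commute[of "S y" "S x"] normalize)
  then show "va_c k V s \<tau> \<nu> = \<ominus>\<^bsub>va_Omega k V\<^esub> va_c k V s \<nu> \<tau>"
    using xy by (simp add: c_eq)
next
  fix a b \<tau> assume "a \<in> carrier (va_A V)" "b \<in> carrier (va_A V)" "\<tau> \<in> carrier (va_T k V)"
  then obtain x where x: "a \<in> V0" "b \<in> V0" "x \<in> V1" "\<tau> = proj x" "S x = x"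
    by (auto elim: T_cases)
  show "va_gamma k V s a (b \<bullet>\<^bsub>va_T k V\<^esub> \<tau>) =
      va_gamma k V s (a \<otimes>\<^bsub>va_A V\<^esub> b) \<tau> \<ominus>\<^bsub>va_Omega k V\<^esub> a \<bullet>\<^bsub>va_Omega k V\<^esub> va_gamma k V s b \<tau>
      \<ominus>\<^bsub>va_Omega k V\<^esub> anchor (va_T k V) \<tau> a \<bullet>\<^bsub>va_Omega k V\<^esub> D b
      \<ominus>\<^bsub>va_Omega k V\<^esub> anchor (va_T k V) \<tau> b \<bullet>\<^bsub>va_Omega k V\<^esub> D a"
    \<comment> \<open>Membership of gamma in Omega is what permits \<open>Omega_minus\<close> to
      replace the subtraction of the record by that of \<open>V\<close>.\<close>
    using gamma_amult[of a b x] gamma_Omega[of b x] x by (simp add: gamma_eq anchor_T)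
next
  fix a \<tau> \<nu> assume "a \<in> carrier (va_A V)" "\<tau> \<in> carrier (va_T k V)" "\<nu> \<in> carrier (va_T k V)"
  then obtain x y where xy: "a \<in> V0" "x \<in> V1" "\<tau> = proj x" "S x = x" "y \<in> V1" "\<nu> = proj y" "S y = y"
    by (auto elim!: T_cases)
  show "va_pair V s (a \<bullet>\<^bsub>va_T k V\<^esub> \<tau>, \<zero>\<^bsub>va_Omega k V\<^esub>) (\<nu>, \<zero>\<^bsub>va_Omega k V\<^esub>) =
      a \<otimes>\<^bsub>va_A V\<^esub> va_pair V s (\<tau>, \<zero>\<^bsub>va_Omega k V\<^esub>) (\<nu>, \<zero>\<^bsub>va_Omega k V\<^esub>)
      \<oplus>\<^bsub>va_A V\<^esub> va_pair V s (\<zero>\<^bsub>va_T k V\<^esub>, va_gamma k V s a \<tau>) (\<nu>, \<zero>\<^bsub>va_Omega k V\<^esub>)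
      \<ominus>\<^bsub>va_A V\<^esub> anchor (va_T k V) \<tau> (anchor (va_T k V) \<nu> a)"
    using pair_amult[of a x y] xy by (simp add: zero_T anchor_T)
  show "va_c k V s (a \<bullet>\<^bsub>va_T k V\<^esub> \<tau>) \<nu> =
      a \<bullet>\<^bsub>va_Omega k V\<^esub> va_c k V s \<tau> \<nu>
      \<oplus>\<^bsub>va_Omega k V\<^esub> va_gamma k V s a (bracket (va_T k V) \<tau> \<nu>)
      \<ominus>\<^bsub>va_Omega k V\<^esub> va_gamma k V s (anchor (va_T k V) \<nu> a) \<tau>
      \<oplus>\<^bsub>va_Omega k V\<^esub> lie_act (va_Omega k V) \<nu> (va_gamma k V s a \<tau>)
      \<ominus>\<^bsub>va_Omega k V\<^esub> half k \<odot>\<^bsub>va_Omega k V\<^esub>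
        (va_pair V s (\<tau>, \<zero>\<^bsub>va_Omega k V\<^esub>) (\<nu>, \<zero>\<^bsub>va_Omega k V\<^esub>) \<bullet>\<^bsub>va_Omega k V\<^esub> D a)
      \<oplus>\<^bsub>va_Omega k V\<^esub> half k \<odot>\<^bsub>va_Omega k V\<^esub> D (anchor (va_T k V) \<tau> (anchor (va_T k V) \<nu> a))
      \<ominus>\<^bsub>va_Omega k V\<^esub> half k \<odot>\<^bsub>va_Omega k V\<^esub>
        D (va_pair V s (\<nu>, \<zero>\<^bsub>va_Omega k V\<^esub>) (\<zero>\<^bsub>va_T k V\<^esub>, va_gamma k V s a \<tau>))"
    using c_amult[of a x y] gamma_Omega[of a x] gamma_Omega[of "y \<rhd> a" x] xy
    by (simp add: zero_T anchor_T gamma_eq pair_eq)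
next
  fix \<tau>\<^sub>1 \<tau>\<^sub>2 \<tau>\<^sub>3
  assume "\<tau>\<^sub>1 \<in> carrier (va_T k V)" "\<tau>\<^sub>2 \<in> carrier (va_T k V)" "\<tau>\<^sub>3 \<in> carrier (va_T k V)"
  then obtain x y z where xyz: "x \<in> V1" "\<tau>\<^sub>1 = proj x" "S x = x" "y \<in> V1" "\<tau>\<^sub>2 = proj y" "S y = y"
    "z \<in> V1" "\<tau>\<^sub>3 = proj z" "S z = z"
    by (auto elim!: T_cases)
  show "va_pair V s (bracket (va_T k V) \<tau>\<^sub>1 \<tau>\<^sub>2, \<zero>\<^bsub>va_Omega k V\<^esub>) (\<tau>\<^sub>3, \<zero>\<^bsub>va_Omega k V\<^esub>) \<oplus>\<^bsub>va_A V\<^esub>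
      va_pair V s (\<tau>\<^sub>2, \<zero>\<^bsub>va_Omega k V\<^esub>) (bracket (va_T k V) \<tau>\<^sub>1 \<tau>\<^sub>3, \<zero>\<^bsub>va_Omega k V\<^esub>) =
      anchor (va_T k V) \<tau>\<^sub>1 (va_pair V s (\<tau>\<^sub>2, \<zero>\<^bsub>va_Omega k V\<^esub>) (\<tau>\<^sub>3, \<zero>\<^bsub>va_Omega k V\<^esub>))
      \<ominus>\<^bsub>va_A V\<^esub> half k \<odot>\<^bsub>va_A V\<^esub>
        anchor (va_T k V) \<tau>\<^sub>2 (va_pair V s (\<tau>\<^sub>1, \<zero>\<^bsub>va_Omega k V\<^esub>) (\<tau>\<^sub>3, \<zero>\<^bsub>va_Omega k V\<^esub>))
      \<ominus>\<^bsub>va_A V\<^esub> half k \<odot>\<^bsub>va_A V\<^esub>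
        anchor (va_T k V) \<tau>\<^sub>3 (va_pair V s (\<tau>\<^sub>1, \<zero>\<^bsub>va_Omega k V\<^esub>) (\<tau>\<^sub>2, \<zero>\<^bsub>va_Omega k V\<^esub>))
      \<oplus>\<^bsub>va_A V\<^esub> va_pair V s (\<tau>\<^sub>2, \<zero>\<^bsub>va_Omega k V\<^esub>) (\<zero>\<^bsub>va_T k V\<^esub>, va_c k V s \<tau>\<^sub>1 \<tau>\<^sub>3)
      \<oplus>\<^bsub>va_A V\<^esub> va_pair V s (\<tau>\<^sub>3, \<zero>\<^bsub>va_Omega k V\<^esub>) (\<zero>\<^bsub>va_T k V\<^esub>, va_c k V s \<tau>\<^sub>1 \<tau>\<^sub>2)"
    using pair_bracket[of x y z] xyz by (simp add: zero_T anchor_T pair_eq)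
  have c: "va_c k V s (proj x) (proj y) \<in> Om" if "x \<in> V1" "y \<in> V1" for x y
    using that by (simp add: c_eq)
  show "vertex_algebroid_data.d_Lie (va_T k V) (va_Omega k V) (va_c k V s) \<tau>\<^sub>1 \<tau>\<^sub>2 \<tau>\<^sub>3 =
      \<ominus>\<^bsub>va_Omega k V\<^esub> (half k \<odot>\<^bsub>va_Omega k V\<^esub> D
        (va_pair V s (bracket (va_T k V) \<tau>\<^sub>1 \<tau>\<^sub>2, \<zero>\<^bsub>va_Omega k V\<^esub>) (\<tau>\<^sub>3, \<zero>\<^bsub>va_Omega k V\<^esub>) \<oplus>\<^bsub>va_A V\<^esub>
          va_pair V s (bracket (va_T k V) \<tau>\<^sub>1 \<tau>\<^sub>3, \<zero>\<^bsub>va_Omega k V\<^esub>) (\<tau>\<^sub>2, \<zero>\<^bsub>va_Omega k V\<^esub>) \<ominus>\<^bsub>va_A V\<^esub>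
          va_pair V s (bracket (va_T k V) \<tau>\<^sub>2 \<tau>\<^sub>3, \<zero>\<^bsub>va_Omega k V\<^esub>) (\<tau>\<^sub>1, \<zero>\<^bsub>va_Omega k V\<^esub>) \<ominus>\<^bsub>va_A V\<^esub>
          anchor (va_T k V) \<tau>\<^sub>1 (va_pair V s (\<tau>\<^sub>2, \<zero>\<^bsub>va_Omega k V\<^esub>) (\<tau>\<^sub>3, \<zero>\<^bsub>va_Omega k V\<^esub>)) \<oplus>\<^bsub>va_A V\<^esub>
          anchor (va_T k V) \<tau>\<^sub>2 (va_pair V s (\<tau>\<^sub>1, \<zero>\<^bsub>va_Omega k V\<^esub>) (\<tau>\<^sub>3, \<zero>\<^bsub>va_Omega k V\<^esub>)) \<ominus>\<^bsub>va_A V\<^esub>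
          [(2::nat)] \<cdot>\<^bsub>va_A V\<^esub>
            va_pair V s (\<tau>\<^sub>3, \<zero>\<^bsub>va_Omega k V\<^esub>) (\<zero>\<^bsub>va_T k V\<^esub>, va_c k V s \<tau>\<^sub>1 \<tau>\<^sub>2)))"
    using d_Lie_c[of x y z] xyz
    by (simp add: vertex_algebroid_data.d_Lie_def bracket_T c pair_eq anchor_T lie_act_T zero_T A_double)
qed (rule is_cring two_unit A_algebra Lie_algebroid_T Omega_amodule)+

end

theorem theorem2p3:
  fixes k :: "('k, 'r) ring_scheme"
    and V :: "('k, 'v, 'm) va_scheme"
    and s :: "'v set \<Rightarrow> 'v"
  assumes "cring k"
    and "\<one>\<^bsub>k\<^esub> \<oplus>\<^bsub>k\<^esub> \<one>\<^bsub>k\<^esub> \<in> Units k"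
    and "graded_vertex_algebra k V"
    and "linear_map k (va_T k V) (va_V1 V) s"
    and "\<And>\<tau>. \<tau> \<in> carrier (va_T k V) \<Longrightarrow> va_proj k V (s \<tau>) = \<tau>"
  shows "vertex_algebroid k (va_A V) (va_T k V) (va_Omega k V) (va_d V)
    (va_gamma k V s) (va_pair V s) (va_c k V s)"
proof -
  interpret gva_split k V s
    using assms
    by (intro gva_split.intro gva_half.intro gva.intro gva_half_axioms.intro gva_split_axioms.intro)
  show ?thesis by (rule vertex_algebroid_V)
qed

end
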